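(* Let $m\in\{1,\dots,11\}$ and let $a,b\in\mathbb{Z}$ be such that $F(x)=x^{12}+ax^m+b$ is irreducible over $\mathbb{Q}$, and let $K=\mathbb{Q}(\alpha)$ where $\alpha$ is a root of $F(x)$. If one of the following conditions holds: (1) $m\in\{3,4,8,9\}$ and $(a,b)\equiv(2,1)\pmod 8$ or $(a,b)\equiv(6,5)\pmod 8$; (2) $m\in\{3,6,9\}$ and $(a,b)\equiv(4,7)\pmod 8$; then $2$ divides $i(K)$. In particular, $K$ is not monogenic.
   Context: Standing assumption: for every rational prime $p$, $\nu_p(a)<12-m$ or $\nu_p(b)<12$, where $\nu_p$ is the $p$-adic valuation. For a number field $K$ with ring of integers $\mathbb{Z}_K$, the index $i(K)$ is the greatest common divisor of the indices $(\mathbb{Z}_K:\mathbb{Z}[\theta])$ over all $\theta\in\mathbb{Z}_K$ generating $K$. $K$ is monogenic if $\mathbb{Z}_K=\mathbb{Z}[\theta]$ for some $\theta\in\mathbb{Z}_K$. $(a,b)\equiv(c,d)\pmod n$ means $a\equiv c$ and $b\equiv d\pmod n$. *)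

theory Defs
  imports
    "HOL-Computational_Algebra.Computational_Algebra"
    "HOL-Number_Theory.Cong"
    "HOL-Library.Extended_Nat"
begin

definition padic_val :: "nat \<Rightarrow> int \<Rightarrow> enat" where
  "padic_val p x = (if x = 0 then \<infinity> else enat (multiplicity (int p) x))"

definition trinomial :: "nat \<Rightarrow> nat \<Rightarrow> int \<Rightarrow> int \<Rightarrow> rat poly" where
  "trinomial n m a b = monom 1 n + monom (of_int a) m + [:of_int b:]"

definition is_subfield :: "'a::field set \<Rightarrow> bool" where
  "is_subfield S \<longleftrightarrow> 0 \<in> S \<and> 1 \<in> S \<and>
     (\<forall>x\<in>S. \<forall>y\<in>S. x + y \<in> S \<and> x * y \<in> S) \<and>
     (\<forall>x\<in>S. - x \<in> S \<and> inverse x \<in> S)"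

(* In characteristic 0 every subfield contains the rationals, so this is the field Q(\<alpha>). *)
definition Q_adjoin :: "'a::field_char_0 \<Rightarrow> 'a set" where
  "Q_adjoin \<alpha> = is_subfield hull {\<alpha>}"

definition Z_adjoin :: "'a::field_char_0 \<Rightarrow> 'a set" where
  "Z_adjoin \<theta> = range (\<lambda>p :: int poly. poly (map_poly of_int p) \<theta>)"

definition ring_of_integers :: "'a::field_char_0 set \<Rightarrow> 'a set" where
  "ring_of_integers K = {x \<in> K. algebraic_int x}"

(* The number of additive cosets of H in G; as a cardinality in nat it is 0 if there are
   infinitely many, which does not occur for Z[\<theta>] in Z_K when \<theta> generates K. *)
definition additive_index :: "'a::ab_group_add set \<Rightarrow> 'a set \<Rightarrow> nat" where
  "additive_index G H = card ((\<lambda>x. (+) x ` H) ` G)"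

definition field_index :: "'a::field_char_0 set \<Rightarrow> nat" where
  "field_index K =
     Gcd {additive_index (ring_of_integers K) (Z_adjoin \<theta>) | \<theta>.
            \<theta> \<in> ring_of_integers K \<and> Q_adjoin \<theta> = K}"

definition monogenic :: "'a::field_char_0 set \<Rightarrow> bool" where
  "monogenic K \<longleftrightarrow> (\<exists>\<theta> \<in> ring_of_integers K. ring_of_integers K = Z_adjoin \<theta>)"

end

theory Submission
  imports Defs "Jordan_Normal_Form.Char_Poly"
begin

text \<open>
  A ring generated over \<open>\<int>\<close> by one element \<open>\<theta>\<close> has, up to Frobenius, at most one homomorphism onto
  \<open>\<F>\<^sub>4\<close>, because \<open>x\<^sup>2 + x + 1\<close> is the only irreducible quadratic over \<open>\<F>\<^sub>2\<close>. If \<open>\<int>[\<theta>]\<close> has odd index in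
  \<open>\<int>\<^sub>K\<close>, the same holds for \<open>\<int>\<^sub>K\<close>. So it suffices to find two non-conjugate homomorphisms
  \<open>\<int>\<^sub>K \<rightarrow> \<F>\<^sub>4\<close>, that is, two primes above 2 with residue field \<open>\<F>\<^sub>4\<close>.

  The Newton polygons of \<open>F\<close> at 2 suggest writing \<open>F = U\<^sup>2 D\<^sub>2 + 2 U D\<^sub>1 + 4 E\<close> in \<open>\<int>[x]\<close>. Then
  \<open>\<eta> = (U D\<^sub>2 + 2 D\<^sub>1)(\<alpha>) / 2\<close> satisfies \<open>\<eta>\<^sup>2 = D\<^sub>1 \<eta> - E D\<^sub>2\<close>, so \<open>R = \<int>[\<alpha>] + \<int>[\<alpha>] \<eta>\<close> is an order, large
  enough for the two primes to be visible and locally principal there. The localisation of \<open>R\<close> at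
  such a prime is a discrete valuation ring; it contains \<open>\<int>\<^sub>K\<close>, so its residue map restricts to \<open>\<int>\<^sub>K\<close>.
\<close>

section \<open>Algebraic integers\<close>

unbundle no fps_syntax

interpretation int_module: Modules.module "\<lambda>(n::int) (x::'a::comm_ring_1). of_int n * x"
  by unfold_locales (simp_all add: algebra_simps)

text \<open>The determinant trick: multiplication by \<open>x\<close> acts on the generators through
  an integer matrix, and the vector of generators, nonzero because of \<open>v\<close>, is an
  eigenvector for \<open>x\<close>. So \<open>x\<close> is a root of the monic characteristic
  polynomial.\<close>

lemma algebraic_int_if_span_invariant:
  fixes x :: "'a::field_char_0"
  assumes "finite V" "v \<in> V" "v \<noteq> 0"
    and inv: "\<And>v. v \<in> V \<Longrightarrow> x * v \<in> int_module.span V"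
  shows "algebraic_int x"
proof -
  obtain vs where vs: "set vs = V" "distinct vs"
    using \<open>finite V\<close> finite_distinct_list by blast
  define n where "n = length vs"
  have "\<exists>c. x * v = (\<Sum>w\<in>V. of_int (c w) * w)" if "v \<in> V" for v
    using inv[OF that] unfolding int_module.span_finite[OF \<open>finite V\<close>] by auto
  then obtain c where c: "\<And>v. v \<in> V \<Longrightarrow> x * v = (\<Sum>w\<in>V. of_int (c v w) * w)"
    by metis
  define A where "A = mat n n (\<lambda>(i, j). c (vs ! i) (vs ! j))"
  have A: "A \<in> carrier_mat n n" by (simp add: A_def)
  let ?A = "map_mat of_int A :: 'a mat"
  have sum_vs: "(\<Sum>w\<in>V. g w) = (\<Sum>j = 0..<n. g (vs ! j))" for g :: "'a \<Rightarrow> 'a"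
  proof -
    have "bij_betw (\<lambda>j. vs ! j) {0..<n} V"
      using bij_betw_nth[OF vs(2), of "{0..<n}" V] vs(1) by (simp add: n_def lessThan_atLeast0)
    then show ?thesis by (rule sum.reindex_bij_betw[symmetric])
  qed
  have "eigenvector ?A (vec n (\<lambda>i. vs ! i)) x"
    unfolding eigenvector_def
  proof (intro conjI)
    obtain i where "i < n" "vs ! i = v"
      using \<open>v \<in> V\<close> vs(1) by (metis in_set_conv_nth n_def)
    then have "vec n (\<lambda>i. vs ! i) $ i \<noteq> 0\<^sub>v n $ i" using \<open>v \<noteq> 0\<close> by simp
    then show "vec n (\<lambda>i. vs ! i) \<noteq> 0\<^sub>v (dim_row ?A)" using A by auto
    show "?A *\<^sub>v vec n (\<lambda>i. vs ! i) = x \<cdot>\<^sub>v vec n (\<lambda>i. vs ! i)"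
    proof (rule eq_vecI)
      fix i assume i: "i < dim_vec (x \<cdot>\<^sub>v vec n (\<lambda>i. vs ! i))"
      then have "vs ! i \<in> V" using vs(1) n_def by auto
      with i show "(?A *\<^sub>v vec n (\<lambda>i. vs ! i)) $ i = (x \<cdot>\<^sub>v vec n (\<lambda>i. vs ! i)) $ i"
        using c[of "vs ! i"] by (simp add: A_def scalar_prod_def sum_vs)
    qed (use A in simp)
  qed (use A in simp)
  then have "eigenvalue ?A x" by (auto simp: eigenvalue_def)
  then have "poly (char_poly ?A) x = 0"
    using eigenvalue_root_char_poly[of ?A n x] A by simp
  then have "poly (map_poly of_int (char_poly A)) x = 0"
    by (simp add: of_int_hom.char_poly_hom[OF A])
  with degree_monic_char_poly[OF A] show ?thesis
    unfolding algebraic_int_altdef_ipoly by metis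
qed

lemma monic_root_power_in_span:
  fixes x :: "'a::field_char_0"
  assumes "lead_coeff f = 1" "poly (map_poly of_int f) x = 0"
  shows "x ^ k \<in> int_module.span ((\<lambda>i. x ^ i) ` {..<degree f})"
proof (induction k rule: less_induct)
  case (less k)
  let ?S = "int_module.span ((\<lambda>i. x ^ i) ` {..<degree f})"
  let ?n = "degree f"
  show ?case
  proof (cases "k < ?n")
    case True then show ?thesis by (auto intro: int_module.span_base)
  next
    case False
    have "poly (map_poly of_int f) x = (\<Sum>i\<le>?n. of_int (coeff f i) * x ^ i)"
      by (simp add: poly_altdef)
    also have "\<dots> = x ^ ?n + (\<Sum>i<?n. of_int (coeff f i) * x ^ i)"
      using assms(1) by (simp add: lessThan_Suc_atMost[symmetric])
    finally have "x ^ ?n = - (\<Sum>i<?n. of_int (coeff f i) * x ^ i)"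
      using assms(2) by (simp add: eq_neg_iff_add_eq_0)
    then have "x ^ (k - ?n) * x ^ ?n = - (\<Sum>i<?n. of_int (coeff f i) * x ^ (i + (k - ?n)))"
      by (simp add: sum_distrib_left power_add mult_ac)
    moreover have "x ^ (k - ?n) * x ^ ?n = x ^ k"
      using False by (simp flip: power_add)
    moreover have "(\<Sum>i<?n. of_int (coeff f i) * x ^ (i + (k - ?n))) \<in> ?S"
      using False by (intro int_module.span_sum int_module.span_scale less.IH) auto
    ultimately show ?thesis
      using int_module.span_neg by metis
  qed
qed

text \<open>The products \<open>x^i * y^j\<close> with exponents below the two degrees span all such
  products, so their span is stable under \<open>x + y\<close>. This makes Z_K an additive group, as
  the coset argument for the index requires.\<close>

lemma algebraic_int_add:
  fixes x y :: "'a::field_char_0"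
  assumes "algebraic_int x" "algebraic_int y"
  shows "algebraic_int (x + y)"
proof -
  obtain f where f: "lead_coeff f = 1" "poly (map_poly of_int f) x = 0"
    using assms(1) unfolding algebraic_int_altdef_ipoly by auto
  obtain g where g: "lead_coeff g = 1" "poly (map_poly of_int g) y = 0"
    using assms(2) unfolding algebraic_int_altdef_ipoly by auto
  define V where "V = (\<lambda>(i, j). x ^ i * y ^ j) ` ({..<degree f} \<times> {..<degree g})"
  have pow: "x ^ i * y ^ j \<in> int_module.span V" for i j
  proof -
    have 1: "x ^ i * y ^ j \<in> int_module.span V" if "j < degree g" for i j
      using monic_root_power_in_span[OF f, of i]
    proof (induction rule: int_module.span_induct_alt)
      case base then show ?case by (simp add: int_module.span_zero)
    next
      case (step c w z)
      then have "w * y ^ j \<in> V" using that by (auto simp: V_def)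
      with step show ?case
        by (simp add: distrib_right mult.assoc int_module.span_add int_module.span_scale int_module.span_base)
    qed
    show ?thesis
      using monic_root_power_in_span[OF g, of j]
    proof (induction rule: int_module.span_induct_alt)
      case base then show ?case by (simp add: int_module.span_zero)
    next
      case (step c w z)
      then have "x ^ i * w \<in> int_module.span V" using 1 by auto
      with step show ?case
        by (simp add: distrib_left mult.left_commute int_module.span_add int_module.span_scale)
    qed
  qed
  have "degree f > 0" 
    using f by (auto intro!: Nat.gr0I elim!: degree_eq_zeroE)
  moreover have "degree g > 0"
    using g by (auto intro!: Nat.gr0I elim!: degree_eq_zeroE)
  ultimately have "1 \<in> V" by (force simp: V_def)
  show ?thesis
  proof (rule algebraic_int_if_span_invariant[where V = V and v = 1])
    fix v assume "v \<in> V"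
    then obtain i j where "v = x ^ i * y ^ j" by (auto simp: V_def)
    then have "(x + y) * v = x ^ Suc i * y ^ j + x ^ i * y ^ Suc j" by (simp add: algebra_simps)
    then show "(x + y) * v \<in> int_module.span V"
      using pow int_module.span_add by metis
  qed (use \<open>1 \<in> V\<close> in \<open>auto simp: V_def\<close>)
qed

section \<open>Subrings and homomorphisms on them\<close>

abbreviation ieval :: "int poly \<Rightarrow> 'a::comm_ring_1 \<Rightarrow> 'a" where
  "ieval p x \<equiv> poly (map_poly of_int p) x"

lemma ieval_pCons [simp]: "ieval (pCons c p) x = of_int c + x * ieval p x"
  by (simp add: Polynomial.map_poly_pCons)

lemma ieval_numeral [simp]: "ieval (numeral n) x = numeral n"
proof -
  have "ieval (of_int (numeral n)) x = of_int (numeral n)"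
    by (simp only: of_int_poly_hom.hom_of_int) simp
  then show ?thesis by simp
qed

lemma ieval_of_int [simp]: "ieval (of_int c) x = of_int c"
  by (simp only: of_int_poly_hom.hom_of_int) simp

lemmas ieval_simps = of_int_poly_hom.hom_add of_int_poly_hom.hom_mult of_int_poly_hom.hom_minus
  of_int_poly_hom.hom_uminus of_int_poly_hom.hom_power

definition subring_set :: "'a::comm_ring_1 set \<Rightarrow> bool" where
  "subring_set R \<longleftrightarrow> 1 \<in> R \<and> (\<forall>x\<in>R. \<forall>y\<in>R. x + y \<in> R \<and> x * y \<in> R \<and> - x \<in> R)"

lemma subring_setD:
  assumes "subring_set R"
  shows "1 \<in> R" "0 \<in> R" "x \<in> R \<Longrightarrow> y \<in> R \<Longrightarrow> x + y \<in> R" "x \<in> R \<Longrightarrow> y \<in> R \<Longrightarrow> x * y \<in> R"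
    "x \<in> R \<Longrightarrow> - x \<in> R" "x \<in> R \<Longrightarrow> y \<in> R \<Longrightarrow> x - y \<in> R" "x \<in> R \<Longrightarrow> x ^ n \<in> R" "of_int c \<in> R"
    "numeral k \<in> R"
proof -
  show 1: "1 \<in> R" and add: "x \<in> R \<Longrightarrow> y \<in> R \<Longrightarrow> x + y \<in> R"
    and mult: "x \<in> R \<Longrightarrow> y \<in> R \<Longrightarrow> x * y \<in> R" and neg: "x \<in> R \<Longrightarrow> - x \<in> R" for x y
    using assms unfolding subring_set_def by auto
  show 0: "0 \<in> R" using add[OF 1 neg[OF 1]] by simp
  show "x \<in> R \<Longrightarrow> y \<in> R \<Longrightarrow> x - y \<in> R" using add[OF _ neg, of x y] by simp
  show "x \<in> R \<Longrightarrow> x ^ n \<in> R" by (induction n) (auto intro: 1 mult)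
  have nat: "of_nat n \<in> R" for n by (induction n) (auto intro: 0 1 add)
  show int: "of_int c \<in> R" for c
    by (cases c rule: int_cases2) (auto intro: nat neg)
  show "numeral k \<in> R" using int[of "numeral k"] by simp
qed

lemma ieval_in_subring:
  assumes "subring_set R" "x \<in> R"
  shows "ieval p x \<in> R"
  by (induction p) (auto intro!: subring_setD[OF assms(1)] assms(2))

text \<open>Subrings are sets inside one ambient field, because the order, its localisations and Z_K
  all have to be compared there; values of the map off the set are unconstrained.\<close>

definition hom_on :: "'a::comm_ring_1 set \<Rightarrow> ('a \<Rightarrow> 'k::comm_ring_1) \<Rightarrow> bool" where
  "hom_on R \<phi> \<longleftrightarrow> subring_set R \<and> \<phi> 1 = 1 \<and>
     (\<forall>x\<in>R. \<forall>y\<in>R. \<phi> (x + y) = \<phi> x + \<phi> y \<and> \<phi> (x * y) = \<phi> x * \<phi> y)"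

lemma hom_onD:
  assumes "hom_on R \<phi>"
  shows "subring_set R" "\<phi> 1 = 1" "\<phi> 0 = 0" "x \<in> R \<Longrightarrow> y \<in> R \<Longrightarrow> \<phi> (x + y) = \<phi> x + \<phi> y"
    "x \<in> R \<Longrightarrow> y \<in> R \<Longrightarrow> \<phi> (x * y) = \<phi> x * \<phi> y" "x \<in> R \<Longrightarrow> \<phi> (- x) = - \<phi> x"
    "x \<in> R \<Longrightarrow> y \<in> R \<Longrightarrow> \<phi> (x - y) = \<phi> x - \<phi> y" "x \<in> R \<Longrightarrow> \<phi> (x ^ n) = \<phi> x ^ n"
    "\<phi> (of_int c) = of_int c" "\<phi> (numeral k) = numeral k"
proof -
  show R: "subring_set R" and 1: "\<phi> 1 = 1"
    and add: "x \<in> R \<Longrightarrow> y \<in> R \<Longrightarrow> \<phi> (x + y) = \<phi> x + \<phi> y"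
    and mult: "x \<in> R \<Longrightarrow> y \<in> R \<Longrightarrow> \<phi> (x * y) = \<phi> x * \<phi> y" for x y
    using assms unfolding hom_on_def by auto
  note R_closed = subring_setD[OF R]
  show 0: "\<phi> 0 = 0" using add[of 0 0] R_closed(2) by simp
  show neg: "x \<in> R \<Longrightarrow> \<phi> (- x) = - \<phi> x" for x
    using add[of x "- x"] R_closed(5)[of x] 0 by (simp add: eq_neg_iff_add_eq_0 add.commute)
  show "x \<in> R \<Longrightarrow> y \<in> R \<Longrightarrow> \<phi> (x - y) = \<phi> x - \<phi> y"
    using add[of x "- y"] neg[of y] R_closed(5)[of y] by simp
  show "x \<in> R \<Longrightarrow> \<phi> (x ^ n) = \<phi> x ^ n"
    by (induction n) (auto simp: 1 mult R_closed)
  have nat: "\<phi> (of_nat n) = of_nat n" for n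
    using R_closed(8)[of "int _"] by (induction n) (auto simp: 0 1 add R_closed)
  show int: "\<phi> (of_int c) = of_int c" for c
    using R_closed(8)[of "int _"] by (cases c rule: int_cases2) (auto simp: nat neg)
  show "\<phi> (numeral k) = numeral k" using int[of "numeral k"] by simp
qed

lemma hom_on_ieval:
  assumes "hom_on R \<phi>" "x \<in> R"
  shows "\<phi> (ieval p x) = ieval p (\<phi> x)"
proof (induction p)
  case (pCons a p)
  note R = hom_onD(1)[OF assms(1)]
  show ?case
    using pCons ieval_in_subring[OF R assms(2)] assms(2)
    by (simp add: hom_onD[OF assms(1)] subring_setD[OF R])
qed (simp add: hom_onD[OF assms(1)])

section \<open>Extending a homomorphism to the algebraic integers\<close>

lemma sum_in_subring:
  assumes "subring_set R" "\<And>i. i \<in> I \<Longrightarrow> f i \<in> R"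
  shows "sum f I \<in> R"
  using assms(2) by (induction I rule: infinite_finite_induct) (auto intro: subring_setD[OF assms(1)])

text \<open>Multiplying a monic equation of degree \<open>n\<close> for \<open>x = c / d\<close> by
  \<open>d^n\<close> leaves a factor \<open>d\<close> in every term except \<open>c^n\<close>. Hence
  a homomorphism that kills \<open>d\<close> also kills \<open>c\<close>, which is how integral
  closedness enters later.\<close>

lemma algebraic_int_cleared_power:
  fixes x :: "'a::field_char_0"
  assumes R: "subring_set R" and "algebraic_int x" "c \<in> R" "d \<in> R" "d * x = c"
  shows "\<exists>n. \<exists>y\<in>R. c ^ n = d * y"
proof -
  obtain f where f: "lead_coeff f = 1" "ieval f x = 0"
    using assms(2) unfolding algebraic_int_altdef_ipoly by auto
  let ?n = "degree f"
  have summand: "d ^ ?n * (of_int (coeff f i) * x ^ i) = of_int (coeff f i) * c ^ i * d ^ (?n - i)"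
    if "i \<le> ?n" for i
  proof -
    have "d ^ ?n = d ^ i * d ^ (?n - i)" using that by (simp flip: power_add)
    then show ?thesis by (simp add: power_mult_distrib mult_ac flip: \<open>d * x = c\<close>)
  qed
  have "0 = d ^ ?n * (\<Sum>i\<le>?n. of_int (coeff f i) * x ^ i)"
    using f(2) by (simp add: poly_altdef)
  also have "\<dots> = (\<Sum>i\<le>?n. of_int (coeff f i) * c ^ i * d ^ (?n - i))"
    unfolding sum_distrib_left by (rule sum.cong) (use summand in auto)
  also have "\<dots> = c ^ ?n + (\<Sum>i<?n. of_int (coeff f i) * c ^ i * d ^ (?n - i))"
    using f(1) by (simp add: lessThan_Suc_atMost[symmetric])
  also have "(\<Sum>i<?n. of_int (coeff f i) * c ^ i * d ^ (?n - i)) =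
      d * (\<Sum>i<?n. of_int (coeff f i) * c ^ i * d ^ (?n - Suc i))"
    unfolding sum_distrib_left
  proof (rule sum.cong)
    fix i assume "i \<in> {..<?n}"
    then have "?n - i = Suc (?n - Suc i)" by simp
    then show "of_int (coeff f i) * c ^ i * d ^ (?n - i) =
        d * (of_int (coeff f i) * c ^ i * d ^ (?n - Suc i))"
      by (simp only: power_Suc mult_ac)
  qed simp
  finally have "c ^ ?n = d * (- (\<Sum>i<?n. of_int (coeff f i) * c ^ i * d ^ (?n - Suc i)))"
    by (simp add: eq_neg_iff_add_eq_0)
  moreover have "- (\<Sum>i<?n. of_int (coeff f i) * c ^ i * d ^ (?n - Suc i)) \<in> R"
    using assms by (intro subring_setD[OF R] sum_in_subring[OF R])
  ultimately show ?thesis by blast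
qed

text \<open>Factors \<open>x\<close> are stripped from a polynomial vanishing at \<open>x\<close>
  until its constant coefficient is nonzero. The integer multiple of \<open>x\<close> so obtained
  bounds how often a uniformiser can divide \<open>x\<close>.\<close>

lemma algebraic_int_divides_int:
  fixes x :: "'a::field_char_0"
  assumes "algebraic_int x" "x \<noteq> 0"
  shows "\<exists>q c. c \<noteq> 0 \<and> x * ieval q x = of_int c"
proof -
  obtain f where "lead_coeff f = 1" "ieval f x = 0"
    using assms(1) unfolding algebraic_int_altdef_ipoly by auto
  then have "f \<noteq> 0" "ieval f x = 0" by auto
  then show ?thesis
  proof (induction f)
    case (pCons c p)
    show ?case
    proof (cases "c = 0")
      case True
      with pCons assms(2) show ?thesis by (auto)
    next
      case False
      have "ieval (pCons c p) x = of_int c + x * ieval p x" by simp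
      then have "x * ieval p x = - of_int c"
        using pCons.prems(2) by (metis add.commute eq_neg_iff_add_eq_0)
      with False show ?thesis by (intro exI[of _ p] exI[of _ "- c"]) simp
    qed
  qed simp
qed

text \<open>If the kernel of \<open>\<phi>\<close> is locally generated by \<open>\<pi>\<close>, the localisation \<open>V\<close> of \<open>R\<close> at this kernel
  is a discrete valuation ring; being integrally closed, it contains all algebraic integers.\<close>

lemma hom_extends_to_algebraic_ints:
  fixes R :: "'a::field_char_0 set" and \<phi> :: "'a \<Rightarrow> 'k::field"
  assumes hom: "hom_on R \<phi>" and int: "\<And>x. x \<in> R \<Longrightarrow> algebraic_int x" and char2: "(2::'k) = 0"
    and \<pi>: "\<pi> \<in> R" "\<phi> \<pi> = 0"
    and principal: "\<And>x. x \<in> R \<Longrightarrow> \<phi> x = 0 \<Longrightarrow> \<exists>t\<in>R. \<phi> t \<noteq> 0 \<and> (\<exists>y\<in>R. t * x = \<pi> * y)"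
    and two: "w \<in> R" "v \<in> R" "\<phi> w \<noteq> 0" "\<phi> v \<noteq> 0" "w * 2 = \<pi> ^ e * v"
  obtains V \<Phi> where "hom_on V \<Phi>" "\<And>x. x \<in> R \<Longrightarrow> \<Phi> x = \<phi> x" "R \<subseteq> V"
    "\<And>y z. y \<in> R \<Longrightarrow> z \<in> R \<Longrightarrow> z \<noteq> 0 \<Longrightarrow> algebraic_int (y / z) \<Longrightarrow> y / z \<in> V"
proof -
  have R: "subring_set R" using hom by (rule hom_onD)
  note [intro] = subring_setD[OF R]
  note [simp] = hom_onD[OF hom] subring_setD[OF R]
  have "e \<noteq> 0"
  proof
    assume "e = 0"
    then have "\<phi> v = \<phi> (w * 2)" using two(5) by simp
    also have "\<dots> = \<phi> w * \<phi> 2" using two(1) by (simp del: hom_onD(10)[OF hom])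
    also have "\<dots> = 0" using char2 by simp
    finally show False using two(4) by simp
  qed
  have "w \<noteq> 0" using two(3) by auto
  then have "\<pi> \<noteq> 0" using two(5) \<open>e \<noteq> 0\<close> by (auto simp: power_0_left)
  have odd: "\<phi> (of_int c) \<noteq> 0" if "odd c" for c
  proof -
    from that obtain k where "c = 2 * k + 1" by (auto elim: oddE)
    then show ?thesis using char2 by simp
  qed
  \<comment> \<open>Some multiple of \<open>x\<close> in \<open>R\<close> is an integer
    \<open>2^k * c'\<close> with \<open>c'\<close> odd, hence a local unit times \<open>2^k\<close>.
    As 2 is \<open>\<pi>^e\<close> up to local units, \<open>\<pi>\<close> divides \<open>x\<close>
    locally at most \<open>e * k\<close> times.\<close>
  have bounded: "\<exists>N. \<forall>n. \<forall>t\<in>R. \<forall>y\<in>R. \<phi> t \<noteq> 0 \<longrightarrow> t * x = \<pi> ^ n * y \<longrightarrow> n \<le> N"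
    if x: "x \<in> R" "x \<noteq> 0" for x
  proof -
    obtain q c where c: "c \<noteq> 0" "x * ieval q x = of_int c"
      using algebraic_int_divides_int[OF int] x by blast
    obtain k c' where c': "c = 2 ^ k * c'" "odd c'"
      using multiplicity_decompose'[of c 2] c(1) by (metis mult.commute odd_one)
    define x' where "x' = ieval q x"
    have x': "x' \<in> R" unfolding x'_def using R x(1) by (rule ieval_in_subring)
    have "n \<le> e * k" if t: "t \<in> R" "y \<in> R" "\<phi> t \<noteq> 0" "t * x = \<pi> ^ n * y" for n t y
    proof (rule ccontr)
      assume "\<not> n \<le> e * k"
      define l where "l = n - e * k"
      have l: "n = e * k + l" "l \<noteq> 0" using \<open>\<not> n \<le> e * k\<close> by (auto simp: l_def)
      have "\<pi> ^ (e * k) * (t * of_int c' * v ^ k) = t * of_int c' * (\<pi> ^ e * v) ^ k"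
        by (simp add: power_mult_distrib power_mult mult_ac)
      also have "\<dots> = t * (of_int c' * 2 ^ k) * w ^ k"
        unfolding two(5)[symmetric] by (simp add: power_mult_distrib mult_ac)
      also have "of_int c' * 2 ^ k = x * x'" using c(2) c'(1) by (simp add: x'_def mult_ac)
      also have "t * (x * x') * w ^ k = (t * x) * x' * w ^ k" by (simp add: mult_ac)
      also have "\<dots> = \<pi> ^ (e * k) * (\<pi> ^ l * (y * x' * w ^ k))"
        unfolding t(4) l(1) by (simp add: power_add mult_ac)
      finally have "t * of_int c' * v ^ k = \<pi> ^ l * (y * x' * w ^ k)"
        using \<open>\<pi> \<noteq> 0\<close> by simp
      then have "\<phi> (t * of_int c' * v ^ k) = \<phi> (\<pi> ^ l * (y * x' * w ^ k))" by simp
      then have "\<phi> t * \<phi> (of_int c') * \<phi> v ^ k = 0"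
        using t two x' \<pi> l(2) by (simp del: hom_onD(9)[OF hom])
      then show False using t(3) two(4) odd[OF c'(2)] by simp
    qed
    then show ?thesis by blast
  qed
  \<comment> \<open>At the greatest exponent the cofactor lies outside the kernel, since otherwise
    \<open>principal\<close> would split off one more \<open>\<pi>\<close>.\<close>
  have valuation: "\<exists>n. \<exists>t\<in>R. \<exists>u\<in>R. \<phi> t \<noteq> 0 \<and> \<phi> u \<noteq> 0 \<and> t * x = \<pi> ^ n * u"
    if x: "x \<in> R" "x \<noteq> 0" for x
  proof -
    define P where "P n \<longleftrightarrow> (\<exists>t\<in>R. \<exists>y\<in>R. \<phi> t \<noteq> 0 \<and> t * x = \<pi> ^ n * y)" for n
    obtain N where N: "\<And>n. P n \<Longrightarrow> n \<le> N"
      using bounded[OF x] unfolding P_def by blast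
    have "P 0" unfolding P_def using x(1) by (intro bexI[of _ 1] bexI[of _ x]) auto
    define n where "n = (GREATEST n. P n)"
    have "P n" unfolding n_def by (rule GreatestI_nat[of P, OF \<open>P 0\<close> N])
    then obtain t y where t: "t \<in> R" "y \<in> R" "\<phi> t \<noteq> 0" "t * x = \<pi> ^ n * y"
      unfolding P_def by blast
    have "\<phi> y \<noteq> 0"
    proof
      assume "\<phi> y = 0"
      then obtain t' y' where t': "t' \<in> R" "\<phi> t' \<noteq> 0" "y' \<in> R" "t' * y = \<pi> * y'"
        using principal t(2) by blast
      have "(t' * t) * x = \<pi> ^ n * (t' * y)" using t(4) by (simp add: mult_ac)
      also have "\<dots> = \<pi> ^ Suc n * y'" unfolding t'(4) by (simp add: mult_ac)
      finally have "P (Suc n)" unfolding P_def using t t' by (intro bexI[of _ "t' * t"] bexI[of _ y']) auto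
      then have "Suc n \<le> n" unfolding n_def by (rule Greatest_le_nat[OF _ N])
      then show False by simp
    qed
    with t show ?thesis by blast
  qed
  \<comment> \<open>The localisation at the kernel is taken inside the ambient field by clearing
    denominators; \<open>\<Phi>_eq\<close> shows that the chosen denominator does not
    matter.\<close>
  define V where "V = {x. \<exists>t\<in>R. \<phi> t \<noteq> 0 \<and> t * x \<in> R}"
  define \<Phi> where "\<Phi> x = (let t = SOME t. t \<in> R \<and> \<phi> t \<noteq> 0 \<and> t * x \<in> R in \<phi> (t * x) / \<phi> t)" for x
  have \<Phi>_eq: "\<Phi> x = \<phi> (t * x) / \<phi> t" if t: "t \<in> R" "\<phi> t \<noteq> 0" "t * x \<in> R" for t x
  proof -
    define s where "s = (SOME t. t \<in> R \<and> \<phi> t \<noteq> 0 \<and> t * x \<in> R)"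
    have s: "s \<in> R" "\<phi> s \<noteq> 0" "s * x \<in> R"
      using someI[of "\<lambda>t. t \<in> R \<and> \<phi> t \<noteq> 0 \<and> t * x \<in> R", OF conjI[OF t(1) conjI[OF t(2,3)]]]
      unfolding s_def by auto
    have "\<phi> (s * (t * x)) = \<phi> (t * (s * x))" by (simp add: mult_ac)
    then have "\<phi> s * \<phi> (t * x) = \<phi> t * \<phi> (s * x)" using s t by simp
    moreover have "\<Phi> x = \<phi> (s * x) / \<phi> s" unfolding \<Phi>_def s_def Let_def ..
    ultimately show ?thesis using s(2) t(2) by (simp add: frac_eq_eq mult.commute)
  qed
  have ring: "x + y \<in> V \<and> x * y \<in> V \<and> - x \<in> V \<and> \<Phi> (x + y) = \<Phi> x + \<Phi> y \<and> \<Phi> (x * y) = \<Phi> x * \<Phi> y"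
    if xy: "x \<in> V" "y \<in> V" for x y
  proof -
    obtain s where s: "s \<in> R" "\<phi> s \<noteq> 0" "s * x \<in> R" using xy unfolding V_def by auto
    obtain t where t: "t \<in> R" "\<phi> t \<noteq> 0" "t * y \<in> R" using xy unfolding V_def by auto
    have eqs: "(s * t) * (x + y) = t * (s * x) + s * (t * y)" "(s * t) * (x * y) = (s * x) * (t * y)"
      "s * (- x) = - (s * x)"
      by (simp_all add: algebra_simps)
    have st: "s * t \<in> R" "\<phi> (s * t) \<noteq> 0" "(s * t) * (x + y) \<in> R" "(s * t) * (x * y) \<in> R" "s * (- x) \<in> R"
      unfolding eqs using s t by auto
    have "\<Phi> (x + y) = \<phi> (t * (s * x) + s * (t * y)) / \<phi> (s * t)"
      using \<Phi>_eq[OF st(1,2,3)] unfolding eqs .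
    also have "\<dots> = (\<phi> t * \<phi> (s * x) + \<phi> s * \<phi> (t * y)) / (\<phi> s * \<phi> t)"
      using s t by simp
    also have "\<dots> = \<Phi> x + \<Phi> y"
      unfolding \<Phi>_eq[OF s] \<Phi>_eq[OF t] using s(2) t(2) by (simp add: field_simps)
    finally have add: "\<Phi> (x + y) = \<Phi> x + \<Phi> y" .
    have "\<Phi> (x * y) = \<phi> ((s * x) * (t * y)) / \<phi> (s * t)"
      using \<Phi>_eq[OF st(1,2,4)] unfolding eqs .
    also have "\<dots> = \<Phi> x * \<Phi> y"
      unfolding \<Phi>_eq[OF s] \<Phi>_eq[OF t] using s t by simp
    finally show ?thesis using add st s unfolding V_def by blast
  qed
  have on_R: "x \<in> V" "\<Phi> x = \<phi> x" if "x \<in> R" for x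
    using that \<Phi>_eq[of 1 x] unfolding V_def by (auto intro!: bexI[of _ 1])
  have "hom_on V \<Phi>"
    unfolding hom_on_def subring_set_def using ring on_R by simp
  moreover have "y / z \<in> V" if yz: "y \<in> R" "z \<in> R" "z \<noteq> 0" "algebraic_int (y / z)" for y z
  proof (cases "y = 0")
    case True
    then show ?thesis using on_R(1)[of 0] by simp
  next
    case False
    obtain i t u where t: "t \<in> R" "u \<in> R" "\<phi> t \<noteq> 0" "\<phi> u \<noteq> 0" "t * y = \<pi> ^ i * u"
      using valuation[OF yz(1) False] by blast
    obtain j t' u' where t': "t' \<in> R" "u' \<in> R" "\<phi> t' \<noteq> 0" "\<phi> u' \<noteq> 0" "t' * z = \<pi> ^ j * u'"
      using valuation[OF yz(2,3)] by blast
    have eq: "\<pi> ^ j * ((t * u') * (y / z)) = \<pi> ^ i * (u * t')"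
    proof -
      have "\<pi> ^ j * ((t * u') * (y / z)) = (\<pi> ^ j * u') * (t * y) / z" by simp
      also have "\<dots> = (t' * z) * (\<pi> ^ i * u) / z" by (simp only: t(5) t'(5))
      finally show ?thesis using yz(3) by simp
    qed
    show ?thesis
    proof (cases "j \<le> i")
      case True
      then have "\<pi> ^ i = \<pi> ^ j * \<pi> ^ (i - j)" by (simp flip: power_add)
      with eq have "\<pi> ^ j * ((t * u') * (y / z)) = \<pi> ^ j * (\<pi> ^ (i - j) * (u * t'))"
        by (simp only: mult.assoc)
      then have "(t * u') * (y / z) = \<pi> ^ (i - j) * (u * t')"
        using \<open>\<pi> \<noteq> 0\<close> by (simp only: mult_left_cancel power_not_zero not_False_eq_True)
      then have "(t * u') * (y / z) \<in> R" using t t' \<pi>(1) by auto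
      then show ?thesis unfolding V_def using t t' by (intro CollectI bexI[of _ "t * u'"]) auto
    next
      \<comment> \<open>A negative valuation would write \<open>y / z\<close> as an element outside
        the kernel over an element \<open>d\<close> of the kernel; integrality makes a power of the
        numerator a multiple of \<open>d\<close>, which is contradictory.\<close>
      case False
      define d where "d = \<pi> ^ (j - i) * (t * u')"
      have "\<pi> ^ j = \<pi> ^ i * \<pi> ^ (j - i)" using False by (simp flip: power_add)
      with eq have "\<pi> ^ i * (d * (y / z)) = \<pi> ^ i * (u * t')"
        by (simp only: d_def mult.assoc)
      then have "d * (y / z) = u * t'"
        using \<open>\<pi> \<noteq> 0\<close> by (simp only: mult_left_cancel power_not_zero not_False_eq_True)
      moreover have d: "d \<in> R" "\<phi> d = 0"
        unfolding d_def using t t' \<pi> False by auto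
      moreover have ut: "u * t' \<in> R" "\<phi> (u * t') \<noteq> 0" using t t' by auto
      ultimately obtain n r where "r \<in> R" "(u * t') ^ n = d * r"
        using algebraic_int_cleared_power[OF R yz(4)] by blast
      then have "\<phi> (u * t') ^ n = \<phi> d * \<phi> r"
        using ut(1) d(1) hom_onD(8)[OF hom ut(1), of n] hom_onD(5)[OF hom d(1), of r] by simp
      with d ut show ?thesis by simp
    qed
  qed
  moreover have "R \<subseteq> V" using on_R by auto
  ultimately show ?thesis using that on_R by blast
qed

section \<open>The field with four elements and the index\<close>

text \<open>\<open>Omega\<close> and \<open>Omega'\<close> are the two roots of
  \<open>x^2 + x + 1\<close>. With explicit tables the field axioms reduce to finite case
  checks.\<close>

datatype gf4 = Zero4 | One4 | Omega | Omega'

instantiation gf4 :: field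
begin

definition "0 = Zero4"
definition "1 = One4"

fun plus_gf4 where
  "Zero4 + y = y"
| "x + Zero4 = x"
| "One4 + One4 = Zero4"
| "One4 + Omega = Omega'"
| "One4 + Omega' = Omega"
| "Omega + One4 = Omega'"
| "Omega + Omega = Zero4"
| "Omega + Omega' = One4"
| "Omega' + One4 = Omega"
| "Omega' + Omega = One4"
| "Omega' + Omega' = Zero4"

fun times_gf4 where
  "Zero4 * y = Zero4"
| "x * Zero4 = Zero4"
| "One4 * y = y"
| "x * One4 = x"
| "Omega * Omega = Omega'"
| "Omega * Omega' = One4"
| "Omega' * Omega = One4"
| "Omega' * Omega' = Omega"

definition "- x = (x :: gf4)"
definition "x - y = x + (y :: gf4)"
text \<open>Nonzero elements satisfy \<open>x^3 = 1\<close>, so the square is the inverse.\<close>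

definition "inverse x = x * (x :: gf4)"
definition "x div y = x * (y * (y :: gf4))"

instance
proof
  fix x y z :: gf4
  show "x + y + z = x + (y + z)" by (cases x; cases y; cases z) simp_all
  show "x + y = y + x" by (cases x; cases y) simp_all
  show "0 + x = x" by (simp add: zero_gf4_def)
  show "- x + x = 0" by (cases x) (simp_all add: uminus_gf4_def zero_gf4_def)
  show "x - y = x + - y" by (simp add: minus_gf4_def uminus_gf4_def)
  show "x * y * z = x * (y * z)" by (cases x; cases y; cases z) simp_all
  show "x * y = y * x" by (cases x; cases y) simp_all
  show "1 * x = x" by (cases x) (simp_all add: one_gf4_def)
  show "(x + y) * z = x * z + y * z" by (cases x; cases y; cases z) simp_all
  show "(0::gf4) \<noteq> 1" by (simp add: zero_gf4_def one_gf4_def)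
  show "x \<noteq> 0 \<Longrightarrow> inverse x * x = 1"
    by (cases x) (simp_all add: inverse_gf4_def zero_gf4_def one_gf4_def)
  show "x div y = x * inverse y" by (simp add: divide_gf4_def inverse_gf4_def)
  show "inverse (0::gf4) = 0" by (simp add: inverse_gf4_def zero_gf4_def)
qed

end

lemma gf4_add_self [simp]: "x + x = (0::gf4)"
  by (cases x) (simp_all add: zero_gf4_def)

lemma gf4_add_self_left [simp]: "x + (x + y) = (y::gf4)"
  by (simp flip: add.assoc)

lemma gf4_numeral [simp]: "numeral (Num.Bit0 n) = (0::gf4)" "numeral (Num.Bit1 n) = (1::gf4)"
  by (simp_all add: numeral.simps)

lemma gf4_minus [simp]: "- x = (x::gf4)" "x - y = x + (y::gf4)"
  by (simp_all add: minus_gf4_def uminus_gf4_def)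

lemma gf4_of_int: "of_int k = (if even k then 0 else 1 :: gf4)"
  by (auto elim!: evenE oddE)

lemma Omega_simps:
  "Omega \<noteq> 0" "Omega \<noteq> 1" "Omega + 1 \<noteq> 0" "1 + Omega \<noteq> 0" "Omega * Omega = Omega + 1"
  "Omega * (Omega + 1) = 1" "Omega * (1 + Omega) = 1" "(Omega + 1) * Omega = 1"
  by (simp_all add: zero_gf4_def one_gf4_def)

declare plus_gf4.simps [simp del] times_gf4.simps [simp del] Omega_simps [simp]

lemma gf4_square_add: "(x + y)\<^sup>2 = x\<^sup>2 + (y::gf4)\<^sup>2"
  by (simp add: power2_sum)

text \<open>Frobenius is additive and fixes the images of integers, hence commutes with integer
  polynomials.\<close>

lemma ieval_gf4_square: "ieval p (x\<^sup>2) = (ieval p x :: gf4)\<^sup>2"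
  by (induction p) (simp_all add: gf4_square_add power_mult_distrib gf4_of_int)

lemma ieval_gf4_prime_field: "x \<in> {0, 1} \<Longrightarrow> ieval p x \<in> {0, 1 :: gf4}"
  by (induction p) (auto simp: gf4_of_int)

text \<open>Translation by \<open>x\<close> permutes the cosets; compare the sums of representatives before and after.\<close>

lemma index_multiple_in_subgroup:
  fixes G H :: "'a::comm_ring_1 set"
  assumes G: "\<And>x y. x \<in> G \<Longrightarrow> y \<in> G \<Longrightarrow> x + y \<in> G"
    and H: "0 \<in> H" "\<And>x y. x \<in> H \<Longrightarrow> y \<in> H \<Longrightarrow> x - y \<in> H"
    and fin: "additive_index G H \<noteq> 0" and x: "x \<in> G"
  shows "of_nat (additive_index G H) * x \<in> H"
proof -
  define Q where "Q = (\<lambda>x. (+) x ` H) ` G"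
  have "finite Q" using fin unfolding additive_index_def Q_def by (metis card.infinite)
  have H_neg: "- y \<in> H" if "y \<in> H" for y using H(2)[OF H(1) that] by simp
  have H_add: "y + z \<in> H" if "y \<in> H" "z \<in> H" for y z using H(2)[OF that(1) H_neg[OF that(2)]] by simp
  have diff: "y - z \<in> H" if "C \<in> Q" "y \<in> C" "z \<in> C" for C y z
  proof -
    obtain g h h' where "h \<in> H" "h' \<in> H" "y = g + h" "z = g + h'"
      using \<open>C \<in> Q\<close> \<open>y \<in> C\<close> \<open>z \<in> C\<close> unfolding Q_def by blast
    then show ?thesis using H(2)[of h h'] by simp
  qed
  define f where "f = (\<lambda>C. (+) x ` C)"
  have fQ: "f C \<in> Q" if "C \<in> Q" for C
  proof -
    obtain g where g: "g \<in> G" "C = (+) g ` H" using \<open>C \<in> Q\<close> unfolding Q_def by blast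
    then have "f C = (+) (x + g) ` H" by (auto simp: f_def image_image add.assoc)
    then show ?thesis unfolding Q_def using G[OF x g(1)] by blast
  qed
  have "inj_on f Q"
    unfolding f_def by (rule inj_onI) (simp add: inj_image_eq_iff)
  then have "bij_betw f Q Q"
    using \<open>finite Q\<close> fQ by (simp add: bij_betw_def endo_inj_surj image_subset_iff)
  define rep where "rep C = (SOME y. y \<in> C)" for C :: "'a set"
  have rep: "rep C \<in> C" if "C \<in> Q" for C
  proof -
    have "C \<noteq> {}" using that H(1) unfolding Q_def by auto
    then show ?thesis unfolding rep_def by (simp add: some_in_eq)
  qed
  have in_H: "x + rep C - rep (f C) \<in> H" if "C \<in> Q" for C
    using rep[OF that] rep[OF fQ[OF that]] fQ[OF that] diff[of "f C"] that by (simp add: f_def)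
  have "(\<Sum>C\<in>Q. x + rep C - rep (f C)) \<in> H"
    using \<open>finite Q\<close> in_H by (induction Q rule: finite_induct) (auto intro: H(1) H_add)
  moreover have "(\<Sum>C\<in>Q. rep (f C)) = (\<Sum>C\<in>Q. rep C)"
    using \<open>bij_betw f Q Q\<close> by (rule sum.reindex_bij_betw)
  ultimately show ?thesis
    by (simp add: sum_subtractf sum.distrib additive_index_def Q_def)
qed

text \<open>An odd \<open>n\<close> maps to 1, so \<open>\<Phi>\<close> and \<open>\<Psi>\<close>
  are given on \<open>S\<close> by evaluating the same integer polynomials at the images of
  \<open>\<theta>\<close>. Those images lie outside the prime field because both maps take values
  there, so they are equal or swapped by Frobenius. Thus \<open>\<Psi> z\<close> is
  \<open>\<Phi> z\<close> or its square, and squaring fixes 0 and 1.\<close>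

lemma odd_index_imp_homs_conjugate:
  fixes \<theta> :: "'a::field_char_0" and \<Phi> \<Psi> :: "'a \<Rightarrow> gf4"
  assumes "hom_on V \<Phi>" "hom_on W \<Psi>" "S \<subseteq> V \<inter> W" "\<theta> \<in> S" "odd n"
    and multiple: "\<And>x. x \<in> S \<Longrightarrow> of_nat n * x \<in> Z_adjoin \<theta>"
    and x: "x \<in> S" "\<Phi> x \<notin> {0, 1}" and y: "y \<in> S" "\<Psi> y \<notin> {0, 1}"
    and z: "z \<in> S" "\<Phi> z \<in> {0, 1}"
  shows "\<Psi> z = \<Phi> z"
proof -
  have eval: "\<exists>p. \<forall>V' \<Phi>'. hom_on V' \<Phi>' \<longrightarrow> S \<subseteq> V' \<longrightarrow> \<Phi>' x = (ieval p (\<Phi>' \<theta>) :: gf4)"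
    if x: "x \<in> S" for x
  proof -
    obtain p where p: "of_nat n * x = ieval p \<theta>"
      using multiple[OF x] unfolding Z_adjoin_def by auto
    have "\<Phi>' x = ieval p (\<Phi>' \<theta>)" if hom: "hom_on V' \<Phi>'" "S \<subseteq> V'" for V' and \<Phi>' :: "'a \<Rightarrow> gf4"
    proof -
      have "of_int (int n) \<in> V'" by (rule subring_setD[OF hom_onD(1)[OF hom(1)]])
      then have "\<Phi>' (of_int (int n) * x) = of_int (int n) * \<Phi>' x"
        using x hom(2) hom_onD(5)[OF hom(1), of "of_int (int n)" x] hom_onD(9)[OF hom(1), of "int n"]
        by auto
      also have "of_int (int n) = (1::gf4)" using \<open>odd n\<close> unfolding gf4_of_int by simp
      finally show ?thesis using p hom_on_ieval[OF hom(1), of \<theta> p] \<open>\<theta> \<in> S\<close> hom(2) by auto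
    qed
    then show ?thesis by blast
  qed
  have generates: "\<Phi>' \<theta> \<notin> {0, 1}" if "hom_on V' \<Phi>'" "S \<subseteq> V'" "x \<in> S" "\<Phi>' x \<notin> {0, 1}"
    for V' x and \<Phi>' :: "'a \<Rightarrow> gf4"
    using eval[OF that(3)] that ieval_gf4_prime_field by metis
  have "\<Phi> \<theta> \<notin> {0, 1}" "\<Psi> \<theta> \<notin> {0, 1}"
    using generates[of V \<Phi> x] generates[of W \<Psi> y] assms by auto
  then have "\<Psi> \<theta> = \<Phi> \<theta> \<or> \<Psi> \<theta> = (\<Phi> \<theta>)\<^sup>2"
    by (cases "\<Phi> \<theta>"; cases "\<Psi> \<theta>") (auto simp: zero_gf4_def one_gf4_def power2_eq_square times_gf4.simps plus_gf4.simps)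
  moreover obtain p where "\<Phi> z = ieval p (\<Phi> \<theta>)" "\<Psi> z = ieval p (\<Psi> \<theta>)"
    using eval[OF z(1)] assms(1-3) by (metis le_inf_iff)
  ultimately show ?thesis using z(2) by (auto simp: ieval_gf4_square)
qed

text \<open>These quotients form a subfield containing \<alpha>. Elements of Z_K thereby become
  fractions over Z[\<alpha>], the form to which the extension argument applies.\<close>

lemma Q_adjoin_eq_quotient:
  assumes "x \<in> Q_adjoin \<alpha>"
  shows "\<exists>p q. ieval q \<alpha> \<noteq> 0 \<and> x = ieval p \<alpha> / ieval q \<alpha>"
proof -
  define S where "S = {x. \<exists>p q. ieval q \<alpha> \<noteq> 0 \<and> x = ieval p \<alpha> / ieval q \<alpha>}"
  have mem: "ieval p \<alpha> / ieval q \<alpha> \<in> S" if "ieval q \<alpha> \<noteq> 0" for p q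
    unfolding S_def using that by blast
  have "is_subfield S"
    unfolding is_subfield_def
  proof (intro conjI ballI)
    show "0 \<in> S" "1 \<in> S" using mem[of 1 0] mem[of 1 1] by simp_all
    fix x assume "x \<in> S"
    then obtain p q where x: "ieval q \<alpha> \<noteq> 0" "x = ieval p \<alpha> / ieval q \<alpha>" unfolding S_def by blast
    show "- x \<in> S" using mem[of q "- p"] x by (simp add: ieval_simps)
    show "inverse x \<in> S"
      using mem[of p q] mem[of 1 0] x by (cases "ieval p \<alpha> = 0") simp_all
    fix y assume "y \<in> S"
    then obtain p' q' where y: "ieval q' \<alpha> \<noteq> 0" "y = ieval p' \<alpha> / ieval q' \<alpha>" unfolding S_def by blast
    show "x + y \<in> S"
      using mem[of "q * q'" "p * q' + p' * q"] x y by (simp add: ieval_simps add_frac_eq)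
    show "x * y \<in> S"
      using mem[of "q * q'" "p * p'"] x y by (simp add: ieval_simps)
  qed
  moreover have "\<alpha> \<in> S" using mem[of 1 "[:0, 1:]"] by simp
  ultimately have "Q_adjoin \<alpha> \<subseteq> S" unfolding Q_adjoin_def by (intro hull_minimal) auto
  then show ?thesis using assms unfolding S_def by blast
qed

section \<open>The order generated by a root and a half-integral element\<close>

text \<open>The assumption \<open>root_iff\<close> presents Z[\<alpha>] as Z[x]/(F), so that
  relations at \<alpha> can be lifted to polynomial identities.\<close>

locale quadratic_order =
  fixes \<alpha> :: "'a::field_char_0" and F U D\<^sub>1 D\<^sub>2 E :: "int poly"
  assumes F_eq: "F = U\<^sup>2 * D\<^sub>2 + 2 * U * D\<^sub>1 + 4 * E"
    and monic: "lead_coeff F = 1"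
    and root_iff: "\<And>p. ieval p \<alpha> = 0 \<longleftrightarrow> F dvd p"
begin

definition \<eta> :: 'a where "\<eta> = ieval (U * D\<^sub>2 + 2 * D\<^sub>1) \<alpha> / 2"

definition R :: "'a set" where "R = {ieval p \<alpha> + ieval q \<alpha> * \<eta> | p q. True}"

lemma in_R: "ieval p \<alpha> + ieval q \<alpha> * \<eta> \<in> R"
  unfolding R_def by blast

lemma ieval_in_R: "ieval p \<alpha> \<in> R"
  using in_R[of p 0] by simp

lemma \<alpha>_in_R: "\<alpha> \<in> R"
  using ieval_in_R[of "[:0, 1:]"] by simp

lemma \<eta>_in_R: "\<eta> \<in> R"
  using in_R[of 0 1] by simp

lemma two_\<eta>: "2 * \<eta> = ieval U \<alpha> * ieval D\<^sub>2 \<alpha> + 2 * ieval D\<^sub>1 \<alpha>"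
  unfolding \<eta>_def by (simp add: ieval_simps)

text \<open>\<open>F\<close> is \<open>U\<close> times the numerator of \<open>\<eta>\<close>, plus
  \<open>4 * E\<close>; at \<alpha> this vanishes and can be halved. Where \<open>E\<close> is a
  local unit, the relation expresses 2 through \<open>U\<close> and \<open>\<eta>\<close>.\<close>

lemma U_\<eta>: "ieval U \<alpha> * \<eta> = - 2 * ieval E \<alpha>"
proof -
  have "ieval F \<alpha> = 0" by (simp add: root_iff)
  then have "ieval U \<alpha> * (ieval U \<alpha> * ieval D\<^sub>2 \<alpha> + 2 * ieval D\<^sub>1 \<alpha>) + 4 * ieval E \<alpha> = 0"
    unfolding F_eq by (simp add: ieval_simps algebra_simps power2_eq_square)
  then have "2 * (ieval U \<alpha> * \<eta> + 2 * ieval E \<alpha>) = 0"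
    unfolding two_\<eta>[symmetric] by (simp add: algebra_simps)
  then have "ieval U \<alpha> * \<eta> + 2 * ieval E \<alpha> = 0" by (metis mult_eq_0_iff zero_neq_numeral)
  then show ?thesis by (simp add: eq_neg_iff_add_eq_0)
qed

text \<open>The formula for \<open>2 * \<eta>\<close> is multiplied by \<open>\<eta>\<close> and
  \<open>U * \<eta>\<close> is replaced using \<open>U_\<eta>\<close>. This is what closes
  \<open>R\<close> under multiplication.\<close>

lemma \<eta>_square: "\<eta>\<^sup>2 = ieval D\<^sub>1 \<alpha> * \<eta> - ieval E \<alpha> * ieval D\<^sub>2 \<alpha>"
proof -
  have "2 * \<eta>\<^sup>2 = (ieval U \<alpha> * \<eta>) * ieval D\<^sub>2 \<alpha> + 2 * ieval D\<^sub>1 \<alpha> * \<eta>"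
    using arg_cong[OF two_\<eta>, of "\<lambda>x. \<eta> * x"] by (simp add: algebra_simps power2_eq_square)
  then have "2 * \<eta>\<^sup>2 = 2 * (ieval D\<^sub>1 \<alpha> * \<eta> - ieval E \<alpha> * ieval D\<^sub>2 \<alpha>)"
    unfolding U_\<eta> by (simp add: algebra_simps)
  then show ?thesis by (metis mult_left_cancel zero_neq_numeral)
qed

lemma R_mult_eq:
  "(ieval p \<alpha> + ieval q \<alpha> * \<eta>) * (ieval p' \<alpha> + ieval q' \<alpha> * \<eta>) =
     ieval (p * p' - q * q' * E * D\<^sub>2) \<alpha> + ieval (p * q' + p' * q + q * q' * D\<^sub>1) \<alpha> * \<eta>"
proof -
  have "(ieval p \<alpha> + ieval q \<alpha> * \<eta>) * (ieval p' \<alpha> + ieval q' \<alpha> * \<eta>) =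
      ieval p \<alpha> * ieval p' \<alpha> + (ieval p \<alpha> * ieval q' \<alpha> + ieval p' \<alpha> * ieval q \<alpha>) * \<eta>
      + ieval q \<alpha> * ieval q' \<alpha> * \<eta>\<^sup>2"
    by (simp add: algebra_simps power2_eq_square)
  then show ?thesis unfolding \<eta>_square by (simp add: ieval_simps algebra_simps)
qed

lemma R_subring: "subring_set R"
  unfolding subring_set_def
proof (intro conjI ballI)
  show "1 \<in> R" using ieval_in_R[of 1] by simp
  fix x y assume "x \<in> R" "y \<in> R"
  then obtain p q p' q' where x: "x = ieval p \<alpha> + ieval q \<alpha> * \<eta>"
    and y: "y = ieval p' \<alpha> + ieval q' \<alpha> * \<eta>"
    unfolding R_def by blast
  show "x + y \<in> R" using in_R[of "p + p'" "q + q'"] unfolding x y by (simp add: ieval_simps algebra_simps)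
  show "x * y \<in> R" unfolding x y R_mult_eq by (rule in_R)
  show "- x \<in> R" using in_R[of "- p" "- q"] unfolding x by (simp add: ieval_simps algebra_simps)
qed

text \<open>\<open>R\<close> is spanned over the integers by the finitely many
  \<open>\<alpha>^i\<close> and \<open>\<alpha>^i * \<eta>\<close> with \<open>i\<close> below the
  degree of \<open>F\<close>, and it is stable under multiplication by \<open>x\<close>.\<close>

lemma R_algebraic_int:
  assumes "x \<in> R"
  shows "algebraic_int x"
proof -
  define V where "V = (\<lambda>i. \<alpha> ^ i) ` {..<degree F} \<union> (\<lambda>i. \<alpha> ^ i * \<eta>) ` {..<degree F}"
  have F0: "ieval F \<alpha> = 0" by (simp add: root_iff)
  have pow: "\<alpha> ^ k \<in> int_module.span V" for k
    using monic_root_power_in_span[OF monic F0, of k] int_module.span_mono[of _ V]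
    unfolding V_def by blast
  have pow_\<eta>: "\<alpha> ^ k * \<eta> \<in> int_module.span V" for k
    using monic_root_power_in_span[OF monic F0, of k]
  proof (induction rule: int_module.span_induct_alt)
    case base then show ?case by (simp add: int_module.span_zero)
  next
    case (step c w z)
    then have "w * \<eta> \<in> V" by (auto simp: V_def)
    with step show ?case
      by (simp add: distrib_right mult.assoc int_module.span_add int_module.span_scale int_module.span_base)
  qed
  have R_span: "y \<in> int_module.span V" if y: "y \<in> R" for y
  proof -
    obtain p q where "y = ieval p \<alpha> + ieval q \<alpha> * \<eta>" using y unfolding R_def by blast
    then have "y = (\<Sum>i\<le>degree p. of_int (coeff p i) * \<alpha> ^ i)
        + (\<Sum>i\<le>degree q. of_int (coeff q i) * (\<alpha> ^ i * \<eta>))"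
      by (simp add: poly_altdef sum_distrib_right mult.assoc)
    then show ?thesis
      using pow pow_\<eta> by (simp add: int_module.span_add int_module.span_sum int_module.span_scale)
  qed
  have "degree F > 0"
    using monic F0 by (auto intro!: Nat.gr0I elim!: degree_eq_zeroE)
  then have "1 \<in> V" by (force simp: V_def)
  show ?thesis
  proof (rule algebraic_int_if_span_invariant[where V = V and v = 1])
    fix v assume "v \<in> V"
    then have "v \<in> R"
      using \<alpha>_in_R \<eta>_in_R by (auto simp: V_def intro!: subring_setD[OF R_subring])
    then show "x * v \<in> int_module.span V"
      by (intro R_span subring_setD[OF R_subring] assms)
  qed (use \<open>1 \<in> V\<close> in \<open>auto simp: V_def\<close>)
qed

end

section \<open>Residue maps of the order and local divisibility\<close>

text \<open>The three conditions on \<open>r\<close> and \<open>s\<close> are the images of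
  \<open>two_\<eta>\<close>, \<open>U_\<eta>\<close> and \<open>\<eta>_square\<close> under \<alpha>
  to \<open>r\<close>, \<open>\<eta>\<close> to \<open>s\<close> in characteristic 2.\<close>

locale quadratic_order_residue = quadratic_order \<alpha> F U D\<^sub>1 D\<^sub>2 E
  for \<alpha> :: "'a::field_char_0" and F U D\<^sub>1 D\<^sub>2 E +
  fixes r s :: "'k::field"
  assumes char2: "(2::'k) = 0"
    and r_U_D2: "ieval U r * ieval D\<^sub>2 r = 0" and r_U: "ieval U r * s = 0"
    and s_square: "s\<^sup>2 = ieval D\<^sub>1 r * s - ieval E r * ieval D\<^sub>2 r"
begin

text \<open>The value at \<open>p(\<alpha>) + q(\<alpha>) \<eta>\<close> does not depend on \<open>p\<close> and \<open>q\<close>: modulo 2, \<open>F\<close> is \<open>U\<close> times the numerator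
  of \<open>\<eta>\<close>, and 2 is a prime element of \<open>\<int>[x]\<close>, so the relations are generated by \<open>(2 E, U)\<close> and
  \<open>(- U D\<^sub>2 - 2 D\<^sub>1, 2)\<close>.\<close>

lemma residue_well_defined:
  assumes "ieval p \<alpha> + ieval q \<alpha> * \<eta> = 0"
  shows "ieval p r + ieval q r * s = 0"
proof -
  let ?D = "U * D\<^sub>2 + 2 * D\<^sub>1"
  have "2 * ieval p \<alpha> + ieval q \<alpha> * (2 * \<eta>) = 0"
    using arg_cong[OF assms, of "\<lambda>x. 2 * x"] by (simp add: algebra_simps)
  then have "ieval (2 * p + q * ?D) \<alpha> = 0" unfolding two_\<eta> by (simp add: ieval_simps)
  then obtain h where "2 * p + q * ?D = F * h" unfolding root_iff by (auto simp: dvd_def)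
  then have *: "(q - h * U) * ?D = 2 * (2 * h * E - p)"
    unfolding F_eq by (simp add: algebra_simps power2_eq_square)
  have two: "(2::int poly) = [:2:]" by (metis numeral_poly)
  have "\<not> 2 dvd ?D"
  proof
    assume "2 dvd ?D"
    moreover have "F = U * ?D + 2 * (2 * E)"
      unfolding F_eq by (simp add: algebra_simps power2_eq_square)
    ultimately have "2 dvd F" by (metis dvd_add dvd_mult dvd_triv_left)
    then have "2 dvd lead_coeff F" unfolding two const_poly_dvd_iff by blast
    then show False using monic by simp
  qed
  moreover have "prime_elem (2::int poly)" unfolding two prime_elem_const_poly_iff by simp
  ultimately have "2 dvd q - h * U"
    using * by (metis dvd_triv_left prime_elem_dvd_multD)
  then obtain k where k: "q - h * U = 2 * k" by (auto simp: dvd_def)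
  then have "2 * (k * ?D) = 2 * (2 * h * E - p)" using * by (simp add: mult.assoc)
  then have "k * ?D = 2 * h * E - p" by simp
  then have p: "p = 2 * h * E - k * ?D" by (simp add: algebra_simps)
  have q: "q = h * U + 2 * k" using k by (simp add: algebra_simps)
  have "ieval p r + ieval q r * s =
      - ieval k r * (ieval U r * ieval D\<^sub>2 r) + ieval h r * (ieval U r * s)
      + 2 * (ieval h r * ieval E r - ieval k r * ieval D\<^sub>1 r + ieval k r * s)"
    unfolding p q by (simp add: ieval_simps algebra_simps)
  then show ?thesis by (simp only: r_U_D2 r_U char2) simp
qed

definition \<phi> :: "'a \<Rightarrow> 'k" where
  "\<phi> x = (SOME c. \<exists>p q. x = ieval p \<alpha> + ieval q \<alpha> * \<eta> \<and> c = ieval p r + ieval q r * s)"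

lemma \<phi>_eq: "\<phi> (ieval p \<alpha> + ieval q \<alpha> * \<eta>) = ieval p r + ieval q r * s"
  unfolding \<phi>_def
proof (rule some_equality)
  fix c assume "\<exists>p' q'. ieval p \<alpha> + ieval q \<alpha> * \<eta> = ieval p' \<alpha> + ieval q' \<alpha> * \<eta> \<and>
    c = ieval p' r + ieval q' r * s"
  then obtain p' q' where eq: "ieval p \<alpha> + ieval q \<alpha> * \<eta> = ieval p' \<alpha> + ieval q' \<alpha> * \<eta>"
    and c: "c = ieval p' r + ieval q' r * s"
    by blast
  have "ieval (p' - p) r + ieval (q' - q) r * s = 0"
    by (rule residue_well_defined) (use eq in \<open>simp add: ieval_simps algebra_simps\<close>)
  then show "c = ieval p r + ieval q r * s"
    unfolding c by (simp add: ieval_simps algebra_simps)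
qed blast

lemma \<phi>_ieval: "\<phi> (ieval p \<alpha>) = ieval p r"
  using \<phi>_eq[of p 0] by simp

lemma \<phi>_\<alpha>: "\<phi> \<alpha> = r"
  using \<phi>_ieval[of "[:0, 1:]"] by simp

lemma \<phi>_\<eta>: "\<phi> \<eta> = s"
  using \<phi>_eq[of 0 1] by simp

lemma \<phi>_hom: "hom_on R \<phi>"
  unfolding hom_on_def
proof (intro conjI ballI)
  show "\<phi> 1 = 1" using \<phi>_ieval[of 1] by simp
  fix x y assume "x \<in> R" "y \<in> R"
  then obtain p q p' q' where x: "x = ieval p \<alpha> + ieval q \<alpha> * \<eta>"
    and y: "y = ieval p' \<alpha> + ieval q' \<alpha> * \<eta>"
    unfolding R_def by blast
  have "x + y = ieval (p + p') \<alpha> + ieval (q + q') \<alpha> * \<eta>"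
    unfolding x y by (simp add: ieval_simps algebra_simps)
  then show "\<phi> (x + y) = \<phi> x + \<phi> y"
    unfolding x y by (simp only: \<phi>_eq) (simp add: ieval_simps algebra_simps)
  have "\<phi> x * \<phi> y = ieval p r * ieval p' r + (ieval p r * ieval q' r + ieval p' r * ieval q r) * s
      + ieval q r * ieval q' r * s\<^sup>2"
    unfolding x y \<phi>_eq by (simp add: algebra_simps power2_eq_square)
  then show "\<phi> (x * y) = \<phi> x * \<phi> y"
    unfolding x y R_mult_eq \<phi>_eq s_square by (simp add: ieval_simps algebra_simps)
qed (rule R_subring)

text \<open>This is the contraction to \<open>R\<close> of the ideal generated by
  \<open>\<pi>\<close> in the localisation at the kernel of \<open>\<phi>\<close>. Being an ideal in
  which local units cancel, it allows local principality to be checked on generators of the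
  kernel.\<close>

definition local_multiples :: "'a \<Rightarrow> 'a set" where
  "local_multiples \<pi> = {x \<in> R. \<exists>t\<in>R. \<phi> t \<noteq> 0 \<and> (\<exists>y\<in>R. t * x = \<pi> * y)}"

lemma local_multiples_mult:
  assumes "x \<in> local_multiples \<pi>" "z \<in> R"
  shows "x * z \<in> local_multiples \<pi>" "z * x \<in> local_multiples \<pi>"
proof -
  note [intro] = subring_setD[OF R_subring]
  obtain t y where t: "t \<in> R" "\<phi> t \<noteq> 0" "y \<in> R" "t * x = \<pi> * y" "x \<in> R"
    using assms(1) unfolding local_multiples_def by blast
  have "t * (x * z) = \<pi> * (y * z)" using t(4) by (metis mult.assoc)
  then show "x * z \<in> local_multiples \<pi>"
    unfolding local_multiples_def using t assms(2) by blast
  then show "z * x \<in> local_multiples \<pi>" by (simp add: mult.commute)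
qed

lemma local_multiples_add:
  assumes "x \<in> local_multiples \<pi>" "y \<in> local_multiples \<pi>"
  shows "x + y \<in> local_multiples \<pi>"
proof -
  note [intro] = subring_setD[OF R_subring]
  obtain t x' where t: "t \<in> R" "\<phi> t \<noteq> 0" "x' \<in> R" "t * x = \<pi> * x'" "x \<in> R"
    using assms(1) unfolding local_multiples_def by blast
  obtain u y' where u: "u \<in> R" "\<phi> u \<noteq> 0" "y' \<in> R" "u * y = \<pi> * y'" "y \<in> R"
    using assms(2) unfolding local_multiples_def by blast
  have "(t * u) * (x + y) = u * (t * x) + t * (u * y)" by (simp add: algebra_simps)
  also have "\<dots> = \<pi> * (u * x' + t * y')" unfolding t(4) u(4) by (simp add: algebra_simps)
  finally have "(t * u) * (x + y) = \<pi> * (u * x' + t * y')" .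
  moreover have "\<phi> (t * u) \<noteq> 0" using t u hom_onD(5)[OF \<phi>_hom] by simp
  moreover have "t * u \<in> R" "u * x' + t * y' \<in> R" "x + y \<in> R" using t u by auto
  ultimately show ?thesis unfolding local_multiples_def by blast
qed

lemma local_multiples_cancel:
  assumes "u * x \<in> local_multiples \<pi>" "u \<in> R" "\<phi> u \<noteq> 0" "x \<in> R"
  shows "x \<in> local_multiples \<pi>"
proof -
  obtain t y where t: "t \<in> R" "\<phi> t \<noteq> 0" "y \<in> R" "t * (u * x) = \<pi> * y"
    using assms(1) unfolding local_multiples_def by blast
  have "(t * u) * x = \<pi> * y" using t(4) by (simp add: mult.assoc)
  moreover have "\<phi> (t * u) \<noteq> 0" "t * u \<in> R"
    using t assms hom_onD(5)[OF \<phi>_hom] subring_setD[OF R_subring] by auto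
  ultimately show ?thesis unfolding local_multiples_def using t(3) assms(4) by blast
qed

lemma local_multiples_base: "\<pi> \<in> R \<Longrightarrow> \<pi> \<in> local_multiples \<pi>"
  unfolding local_multiples_def using hom_onD(2)[OF \<phi>_hom] subring_setD(1)[OF R_subring]
  by (intro CollectI conjI bexI[of _ 1]) auto

text \<open>The last hypothesis says that 2 is \<open>\<pi>^e\<close> up to local units, so
  \<open>e\<close> is the ramification index. Then \<open>\<pi>\<close> is a uniformiser and the
  discrete valuation ring contains Z_K.\<close>

lemma extends_to_ring_of_integers:
  assumes "\<pi> \<in> R" "\<phi> \<pi> = 0" and ker: "\<And>x. x \<in> R \<Longrightarrow> \<phi> x = 0 \<Longrightarrow> x \<in> local_multiples \<pi>"
    and "w \<in> R" "v \<in> R" "\<phi> w \<noteq> 0" "\<phi> v \<noteq> 0" "w * 2 = \<pi> ^ e * v"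
  shows "\<exists>V \<Phi>. hom_on V \<Phi> \<and> ring_of_integers (Q_adjoin \<alpha>) \<subseteq> V \<and> \<Phi> \<alpha> = r \<and> \<Phi> \<eta> = s"
proof -
  have principal: "\<exists>t\<in>R. \<phi> t \<noteq> 0 \<and> (\<exists>y\<in>R. t * x = \<pi> * y)" if "x \<in> R" "\<phi> x = 0" for x
    using ker[OF that] unfolding local_multiples_def by blast
  obtain V \<Phi> where V: "hom_on V \<Phi>" "\<And>x. x \<in> R \<Longrightarrow> \<Phi> x = \<phi> x" "R \<subseteq> V"
    "\<And>y z. y \<in> R \<Longrightarrow> z \<in> R \<Longrightarrow> z \<noteq> 0 \<Longrightarrow> algebraic_int (y / z) \<Longrightarrow> y / z \<in> V"
    using hom_extends_to_algebraic_ints[OF \<phi>_hom R_algebraic_int char2 assms(1,2) principal assms(4-8)] by blast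
  have "ring_of_integers (Q_adjoin \<alpha>) \<subseteq> V"
  proof
    fix x assume "x \<in> ring_of_integers (Q_adjoin \<alpha>)"
    then have "x \<in> Q_adjoin \<alpha>" "algebraic_int x" by (auto simp: ring_of_integers_def)
    moreover from this obtain p q where "ieval q \<alpha> \<noteq> 0" "x = ieval p \<alpha> / ieval q \<alpha>"
      using Q_adjoin_eq_quotient by blast
    ultimately show "x \<in> V" using V(4)[OF ieval_in_R ieval_in_R] by blast
  qed
  moreover have "\<Phi> \<alpha> = r" "\<Phi> \<eta> = s" using V(2) \<alpha>_in_R \<eta>_in_R \<phi>_\<alpha> \<phi>_\<eta> by simp_all
  ultimately show ?thesis using V(1) by blast
qed

end

section \<open>Parity of the index\<close>

lemma subfield_Q_adjoin: "is_subfield (Q_adjoin \<alpha>)"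
  unfolding Q_adjoin_def
proof (rule hull_in)
  fix \<S> :: "'a set set" assume "Ball \<S> is_subfield"
  then show "is_subfield (\<Inter> \<S>)" unfolding is_subfield_def by simp
qed

lemma ring_of_integers_add:
  assumes "x \<in> ring_of_integers (Q_adjoin \<alpha>)" "y \<in> ring_of_integers (Q_adjoin \<alpha>)"
  shows "x + y \<in> ring_of_integers (Q_adjoin \<alpha>)"
  using assms subfield_Q_adjoin[of \<alpha>] algebraic_int_add[of x y]
  by (auto simp: ring_of_integers_def is_subfield_def)

lemma Z_adjoin_diff: "x \<in> Z_adjoin \<theta> \<Longrightarrow> y \<in> Z_adjoin \<theta> \<Longrightarrow> x - y \<in> Z_adjoin \<theta>"
proof -
  assume "x \<in> Z_adjoin \<theta>" "y \<in> Z_adjoin \<theta>"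
  then obtain p q where "x = ieval p \<theta>" "y = ieval q \<theta>" unfolding Z_adjoin_def by blast
  then have "x - y = ieval (p - q) \<theta>" by (simp add: ieval_simps)
  then show ?thesis unfolding Z_adjoin_def by blast
qed

text \<open>Frobenius fixes \<open>{0, 1}\<close>, so conjugate homomorphisms agree wherever one of them has a value there.\<close>

definition nonconjugate_gf4_homs :: "'a::field_char_0 set \<Rightarrow> bool" where
  "nonconjugate_gf4_homs S \<longleftrightarrow> (\<exists>V (\<Phi> :: 'a \<Rightarrow> gf4) W (\<Psi> :: 'a \<Rightarrow> gf4).
     hom_on V \<Phi> \<and> hom_on W \<Psi> \<and> S \<subseteq> V \<inter> W \<and>
     (\<exists>x\<in>S. \<Phi> x \<notin> {0, 1}) \<and> (\<exists>y\<in>S. \<Psi> y \<notin> {0, 1}) \<and> (\<exists>z\<in>S. \<Phi> z \<in> {0, 1} \<and> \<Psi> z \<noteq> \<Phi> z))"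

lemma nonconjugate_gf4_homsI:
  fixes \<Phi> \<Psi> :: "'a::field_char_0 \<Rightarrow> gf4"
  assumes "hom_on V \<Phi>" "S \<subseteq> V" "hom_on W \<Psi>" "S \<subseteq> W" "x \<in> S" "\<Phi> x \<notin> {0, 1}" "y \<in> S" "\<Psi> y \<notin> {0, 1}"
    "z \<in> S" "\<Phi> z \<in> {0, 1}" "\<Psi> z \<noteq> \<Phi> z"
  shows "nonconjugate_gf4_homs S"
  unfolding nonconjugate_gf4_homs_def
  by (rule exI[of _ V], rule exI[of _ \<Phi>], rule exI[of _ W], rule exI[of _ \<Psi>]) (use assms in blast)

text \<open>Taking \<open>n\<close> to be the index yields its evenness; \<open>n = 1\<close> rules
  out Z_K = Z[\<theta>].\<close>

lemma no_odd_multiple_in_Z_adjoin: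
  assumes "nonconjugate_gf4_homs S" "\<theta> \<in> S" "odd n"
  shows "\<exists>x\<in>S. of_nat n * x \<notin> Z_adjoin \<theta>"
proof (rule ccontr)
  assume *: "\<not> ?thesis"
  obtain V W x y z and \<Phi> \<Psi> :: "'a \<Rightarrow> gf4" where h: "hom_on V \<Phi>" "hom_on W \<Psi>" "S \<subseteq> V \<inter> W"
    "x \<in> S" "\<Phi> x \<notin> {0, 1}" "y \<in> S" "\<Psi> y \<notin> {0, 1}" "z \<in> S" "\<Phi> z \<in> {0, 1}" "\<Psi> z \<noteq> \<Phi> z"
    using assms(1) unfolding nonconjugate_gf4_homs_def by blast
  have "\<Psi> z = \<Phi> z"
    by (rule odd_index_imp_homs_conjugate[OF h(1,2,3) assms(2,3) _ h(4-9)]) (use * in blast)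
  then show False using h(10) by simp
qed

lemma index_even:
  assumes "nonconjugate_gf4_homs (ring_of_integers (Q_adjoin \<alpha>))"
    and "\<theta> \<in> ring_of_integers (Q_adjoin \<alpha>)"
  shows "even (additive_index (ring_of_integers (Q_adjoin \<alpha>)) (Z_adjoin \<theta>))"
proof (rule ccontr)
  \<comment> \<open>An odd index is nonzero, so it is a true coset count: the value 0 standing for
    infinitely many cosets is even.\<close>
  assume odd: "odd (additive_index (ring_of_integers (Q_adjoin \<alpha>)) (Z_adjoin \<theta>))"
  have "0 \<in> Z_adjoin \<theta>" unfolding Z_adjoin_def by (rule image_eqI[of _ _ 0]) simp_all
  then have "of_nat (additive_index (ring_of_integers (Q_adjoin \<alpha>)) (Z_adjoin \<theta>)) * x \<in> Z_adjoin \<theta>"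
    if "x \<in> ring_of_integers (Q_adjoin \<alpha>)" for x
    using that odd
    by (intro index_multiple_in_subgroup ring_of_integers_add Z_adjoin_diff) (auto dest: odd_pos)
  then show False using no_odd_multiple_in_Z_adjoin[OF assms odd] by blast
qed

lemma (in quadratic_order) R_subset_ring_of_integers: "R \<subseteq> ring_of_integers (Q_adjoin \<alpha>)"
proof
  fix x assume "x \<in> R"
  have K: "is_subfield (Q_adjoin \<alpha>)" by (rule subfield_Q_adjoin)
  then have sub: "subring_set (Q_adjoin \<alpha>)" unfolding is_subfield_def subring_set_def by blast
  have "\<alpha> \<in> Q_adjoin \<alpha>" unfolding Q_adjoin_def by (rule hull_inc) simp
  then have ev: "ieval p \<alpha> \<in> Q_adjoin \<alpha>" for p by (rule ieval_in_subring[OF sub])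
  have "inverse 2 \<in> Q_adjoin \<alpha>"
    using K subring_setD(9)[OF sub] unfolding is_subfield_def by blast
  then have "\<eta> \<in> Q_adjoin \<alpha>"
    unfolding \<eta>_def divide_inverse using ev subring_setD(4)[OF sub] by blast
  with ev have "x \<in> Q_adjoin \<alpha>"
    using \<open>x \<in> R\<close> unfolding R_def by (auto intro!: subring_setD(3,4)[OF sub])
  then show "x \<in> ring_of_integers (Q_adjoin \<alpha>)"
    using R_algebraic_int[OF \<open>x \<in> R\<close>] by (simp add: ring_of_integers_def)
qed

section \<open>Generators of the kernel of a residue map\<close>

text \<open>Division by the monic \<open>x^2 + x + 1\<close> leaves a remainder
  \<open>c + d * x\<close>; since 1 and \<open>Omega\<close> are independent over the prime field,
  it vanishes at \<open>Omega\<close> only if \<open>c\<close> and \<open>d\<close> are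
  even.\<close>

lemma ieval_Omega_eq_0D:
  assumes "ieval g Omega = 0"
  shows "\<exists>k c d. g = [:1, 1, 1:] * k + 2 * [:c, d:]"
proof -
  have "\<exists>k c d. g = [:1, 1, 1:] * k + [:c, d:]"
  proof (induction g)
    case 0
    show ?case by (rule exI[of _ 0], rule exI[of _ 0], rule exI[of _ 0]) simp
  next
    case (pCons a g)
    then obtain k c d where "g = [:1, 1, 1:] * k + [:c, d:]" by blast
    \<comment> \<open>Uses
      \<open>x * (c + d * x) = d * (x^2 + x + 1) + (c - d) * x - d\<close>.\<close>
    then have "pCons a g = [:1, 1, 1:] * (pCons d k) + [:a - d, c - d:]" by simp
    then show ?case by blast
  qed
  then obtain k c d where g: "g = [:1, 1, 1:] * k + [:c, d:]" by blast
  have "ieval g Omega = ieval [:1, 1, 1:] Omega * ieval k Omega + ieval [:c, d:] Omega"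
    by (simp only: g ieval_simps poly_add poly_mult)
  then have "ieval g Omega = of_int c + Omega * of_int d" by simp
  then have "even c \<and> even d"
    using assms by (auto simp: gf4_of_int split: if_splits)
  then obtain c' d' where "c = 2 * c'" "d = 2 * d'" by (auto elim!: evenE)
  then have "g = [:1, 1, 1:] * k + 2 * [:c', d':]" unfolding g by (simp add: numeral_poly)
  then show ?thesis by blast
qed

locale gf4_residue = quadratic_order_residue \<alpha> F U D\<^sub>1 D\<^sub>2 E r s
  for \<alpha> :: "'a::field_char_0" and F U D\<^sub>1 D\<^sub>2 E and r s :: gf4
begin

lemmas R_closed = subring_setD[OF R_subring] \<alpha>_in_R \<eta>_in_R ieval_in_R
lemmas \<phi>_simps = hom_onD(2-)[OF \<phi>_hom] R_closed

lemma ieval_in_local_multiples: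
  assumes "r = Omega" "2 \<in> local_multiples \<pi>" "\<alpha>\<^sup>2 + \<alpha> + 1 \<in> local_multiples \<pi>" "ieval g Omega = 0"
  shows "ieval g \<alpha> \<in> local_multiples \<pi>"
proof -
  obtain k c d where g: "g = [:1, 1, 1:] * k + 2 * [:c, d:]" using ieval_Omega_eq_0D[OF assms(4)] by blast
  have "ieval g \<alpha> = ieval [:1, 1, 1:] \<alpha> * ieval k \<alpha> + ieval 2 \<alpha> * ieval [:c, d:] \<alpha>"
    by (simp only: g ieval_simps poly_add poly_mult)
  then have "ieval g \<alpha> = (\<alpha>\<^sup>2 + \<alpha> + 1) * ieval k \<alpha> + 2 * ieval [:c, d:] \<alpha>"
    by (simp add: algebra_simps power2_eq_square)
  then show ?thesis
    using local_multiples_add[OF local_multiples_mult(1)[OF assms(3)] local_multiples_mult(1)[OF assms(2)]]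
      ieval_in_R by metis
qed

text \<open>Replacing \<open>\<eta>\<close> by \<open>\<sigma>(\<alpha>)\<close> turns
  \<open>x\<close> into a polynomial in \<alpha> that vanishes at \<open>Omega\<close>. So the
  kernel is generated by 2, \<open>\<alpha>^2 + \<alpha> + 1\<close> and
  \<open>\<eta> - \<sigma>(\<alpha>)\<close>.\<close>

lemma kernel_in_local_multiples:
  assumes "r = Omega" "s = ieval \<sigma> Omega" "2 \<in> local_multiples \<pi>" "\<alpha>\<^sup>2 + \<alpha> + 1 \<in> local_multiples \<pi>"
    and "\<eta> - ieval \<sigma> \<alpha> \<in> local_multiples \<pi>" "x \<in> R" "\<phi> x = 0"
  shows "x \<in> local_multiples \<pi>"
proof -
  obtain p q where x: "x = ieval p \<alpha> + ieval q \<alpha> * \<eta>" using \<open>x \<in> R\<close> unfolding R_def by blast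
  have "ieval (p + q * \<sigma>) Omega = 0"
    using \<open>\<phi> x = 0\<close> unfolding x \<phi>_eq by (simp add: ieval_simps assms)
  then have "ieval (p + q * \<sigma>) \<alpha> \<in> local_multiples \<pi>"
    by (rule ieval_in_local_multiples[OF assms(1,3,4)])
  moreover have "x = ieval (p + q * \<sigma>) \<alpha> + ieval q \<alpha> * (\<eta> - ieval \<sigma> \<alpha>)"
    unfolding x by (simp add: ieval_simps algebra_simps)
  ultimately show ?thesis
    using local_multiples_add local_multiples_mult(2)[OF assms(5) ieval_in_R] by metis
qed

end

section \<open>Primes above 2\<close>

context gf4_residue
begin

text \<open>The cofactor \<open>\<alpha> - 1\<close> in \<open>\<alpha>^3 - 1\<close> maps to
  \<open>Omega - 1\<close>, hence is a local unit.\<close>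

lemma quadratic_in_local_multiples:
  assumes r: "r = Omega" and "\<alpha> ^ 3 - 1 \<in> local_multiples \<pi>"
  shows "\<alpha>\<^sup>2 + \<alpha> + 1 \<in> local_multiples \<pi>"
proof (rule local_multiples_cancel[of "\<alpha> - 1"])
  have "(\<alpha> - 1) * (\<alpha>\<^sup>2 + \<alpha> + 1) = \<alpha> ^ 3 - 1"
    by (simp add: algebra_simps power2_eq_square power3_eq_cube)
  then show "(\<alpha> - 1) * (\<alpha>\<^sup>2 + \<alpha> + 1) \<in> local_multiples \<pi>" using assms(2) by simp
qed (simp_all add: \<phi>_simps trans[OF \<phi>_\<alpha> r])

text \<open>The uniformiser is 2 in the first case (unramified prime) and \<open>\<alpha>\<^sup>3 - 1\<close> in the next two (ramification
  index 3 and 2); at \<open>\<alpha> \<mapsto> 1\<close> it is \<open>\<alpha> - 1\<close> (index 2), and in the Eisenstein case \<open>\<alpha>\<^sup>2 + \<alpha> + 1\<close>.\<close>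

lemma extension_tame_1:
  assumes U: "U = [:-1, 0, 0, 1:]" and D\<^sub>1: "D\<^sub>1 = of_int u" and E: "E = of_int c"
    and D\<^sub>2: "D\<^sub>2 = U\<^sup>2 + 2 * of_int k\<^sub>3 * U + 2 * of_int k\<^sub>2" and "odd u" and r: "r = Omega" and s: "s = 1"
  shows "\<exists>V \<Phi>. hom_on V \<Phi> \<and> ring_of_integers (Q_adjoin \<alpha>) \<subseteq> V \<and> \<Phi> \<alpha> = r \<and> \<Phi> \<eta> = s"
proof (rule extends_to_ring_of_integers[where \<pi> = 2 and w = 1 and v = 1 and e = 1])
  note res = \<phi>_simps trans[OF \<phi>_\<alpha> r] trans[OF \<phi>_\<eta> s]
  define g where "g = \<alpha> ^ 3 - 1"
  have g: "ieval U \<alpha> = g" unfolding U g_def by (simp add: power3_eq_cube)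
  have d: "ieval D\<^sub>2 \<alpha> = g * g + 2 * (of_int k\<^sub>3 * g + of_int k\<^sub>2)"
    unfolding D\<^sub>2 by (simp add: ieval_simps g algebra_simps power2_eq_square)
  have gR: "g \<in> R" using ieval_in_R[of U] g by simp
  have two: "2 \<in> local_multiples 2" by (simp add: local_multiples_base R_closed)
  \<comment> \<open>As \<open>s = 1\<close>, \<open>\<eta>\<close> is a local unit; cancelling it
    makes \<open>g\<close> divisible by 2, and below it makes \<open>\<eta> - u\<close> divisible by
    2.\<close>
  have "\<eta> * g = 2 * (- of_int c)" using U_\<eta> by (simp add: g E mult.commute)
  then have "\<eta> * g \<in> local_multiples 2"
    using local_multiples_mult(1)[OF two, of "- of_int c"] by (simp add: R_closed)
  then have g2: "g \<in> local_multiples 2"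
    by (rule local_multiples_cancel) (simp_all add: gR res)
  have quad: "\<alpha>\<^sup>2 + \<alpha> + 1 \<in> local_multiples 2"
    using g2 unfolding g_def by (rule quadratic_in_local_multiples[OF r])
  have "ieval D\<^sub>2 \<alpha> \<in> local_multiples 2"
    unfolding d by (intro local_multiples_add local_multiples_mult g2 two) (simp_all add: gR R_closed)
  moreover have "\<eta> * (\<eta> - of_int u) = ieval D\<^sub>2 \<alpha> * (- of_int c)"
    using \<eta>_square by (simp add: D\<^sub>1 E algebra_simps power2_eq_square)
  ultimately have "\<eta> * (\<eta> - of_int u) \<in> local_multiples 2"
    using local_multiples_mult(1)[of _ 2 "- of_int c"] by (simp add: R_closed)
  then have "\<eta> - of_int u \<in> local_multiples 2"
    by (rule local_multiples_cancel) (simp_all add: res)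
  moreover obtain u' where "u = 2 * u' + 1" using \<open>odd u\<close> by (rule oddE)
  then have "\<eta> - 1 = (\<eta> - of_int u) + 2 * of_int u'" by simp
  ultimately have "\<eta> - 1 \<in> local_multiples 2"
    using local_multiples_add local_multiples_mult(1)[OF two] R_closed(8) by metis
  then show "x \<in> local_multiples 2" if "x \<in> R" "\<phi> x = 0" for x
    using kernel_in_local_multiples[OF r _ two quad, of 1 x] that s by simp
qed (simp_all add: \<phi>_simps)

text \<open>Now \<open>\<eta>\<close> is in the kernel and \<open>w = u - \<eta>\<close> is the
  local unit, \<open>u\<close> being odd. Its products with 2 and with \<open>\<eta>\<close> are
  multiples of \<open>d\<close>, which gives the divisibility by \<open>g\<close>.\<close>

lemma extension_tame_0:
  assumes U: "U = [:-1, 0, 0, 1:]" and D\<^sub>1: "D\<^sub>1 = of_int u" and E: "E = of_int c"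
    and D\<^sub>2: "D\<^sub>2 = U\<^sup>2 + 2 * of_int k\<^sub>3 * U + 2 * of_int k\<^sub>2" and "odd u" and r: "r = Omega" and s: "s = 0"
  shows "\<exists>V \<Phi>. hom_on V \<Phi> \<and> ring_of_integers (Q_adjoin \<alpha>) \<subseteq> V \<and> \<Phi> \<alpha> = r \<and> \<Phi> \<eta> = s"
proof -
  note res = \<phi>_simps trans[OF \<phi>_\<alpha> r] trans[OF \<phi>_\<eta> s]
  define g where "g = \<alpha> ^ 3 - 1"
  define d where "d = ieval D\<^sub>2 \<alpha>"
  define k where "k = of_int k\<^sub>3 * g + of_int k\<^sub>2"
  define w where "w = of_int u - \<eta>"
  have g: "ieval U \<alpha> = g" unfolding U g_def by (simp add: power3_eq_cube)
  have d: "d = g * g + 2 * k"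
    unfolding d_def D\<^sub>2 k_def by (simp add: ieval_simps g algebra_simps power2_eq_square)
  have gR: "g \<in> R" "\<phi> g = 0"
    unfolding g_def by (simp_all add: res power3_eq_cube)
  have wR: "w \<in> R" "\<phi> w = 1"
    unfolding w_def using \<open>odd u\<close> by (simp_all add: res gf4_of_int)
  have kR: "k \<in> R" unfolding k_def by (simp add: gR R_closed)
  have dR: "d \<in> R" "\<phi> d = 0" unfolding d using gR kR by (simp_all add: res)
  have pi: "g \<in> local_multiples g" using gR(1) by (rule local_multiples_base)
  have w2: "w * 2 = g * (- d)"
    using two_\<eta> unfolding w_def d_def by (simp add: D\<^sub>1 g algebra_simps)
  then have "w * 2 \<in> local_multiples g"
    using local_multiples_mult(1)[OF pi, of "- d"] dR by (simp add: R_closed)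
  then have two: "2 \<in> local_multiples g"
    by (rule local_multiples_cancel) (simp_all add: wR R_closed)
  have quad: "\<alpha>\<^sup>2 + \<alpha> + 1 \<in> local_multiples g"
    using pi unfolding g_def by (rule quadratic_in_local_multiples[OF r])
  have "d \<in> local_multiples g"
    unfolding d by (intro local_multiples_add local_multiples_mult pi two) (simp_all add: gR kR)
  moreover have "w * \<eta> = d * of_int c"
    using \<eta>_square unfolding w_def d_def by (simp add: D\<^sub>1 E algebra_simps power2_eq_square)
  ultimately have "w * \<eta> \<in> local_multiples g"
    using local_multiples_mult(1)[of _ g "of_int c"] by (simp add: R_closed)
  then have \<eta>: "\<eta> \<in> local_multiples g"
    by (rule local_multiples_cancel) (simp_all add: wR R_closed)
  show ?thesis
  proof (rule extends_to_ring_of_integers[OF gR])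
    show "x \<in> local_multiples g" if "x \<in> R" "\<phi> x = 0" for x
      using kernel_in_local_multiples[OF r _ two quad, of 0 x] that s \<eta> by simp
    \<comment> \<open>Inserting \<open>d = g^2 + 2 * k\<close> into \<open>w2\<close> gives
      \<open>2 * (w + k * g) = - g^3\<close>. Multiplied by
      \<open>w^2 - k * w * g + k^2 * g^2\<close> and rearranged, this shows 2 to be
      \<open>g^3\<close> up to local units.\<close>
    have "w ^ 3 * 2 + g ^ 3 * (w * w - k * w * g + d * k * k) =
        (w * 2 + g * d) * (w * w - k * w * g + k * k * g * g)"
      unfolding d by (simp add: algebra_simps power3_eq_cube)
    also have "w * 2 + g * d = 0" using w2 by simp
    finally have "w ^ 3 * 2 + g ^ 3 * (w * w - k * w * g + d * k * k) = 0" by simp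
    then show "w ^ 3 * 2 = g ^ 3 * (- (w * w - k * w * g + d * k * k))"
      by (simp only: mult_minus_right eq_neg_iff_add_eq_0)
  qed (use gR wR kR dR in \<open>simp_all add: res\<close>)
qed

text \<open>Since \<open>c\<close> is odd, \<open>f\<close> is a local unit, and
  \<open>U_\<eta>\<close> makes 2 equal to \<open>g^2\<close> up to local units. The residue of
  \<open>\<eta>\<close> satisfies \<open>x^2 + x + 1 = 0\<close>, so both \<open>Omega\<close> and
  \<open>Omega + 1\<close> are possible.\<close>

lemma extension_wild_cube:
  assumes U: "U = [:-1, 0, 0, 1:]\<^sup>2" and D\<^sub>1: "D\<^sub>1 = of_int k\<^sub>3 * [:-1, 0, 0, 1:] + of_int k\<^sub>2"
    and E: "E = of_int k\<^sub>1 * [:-1, 0, 0, 1:] + of_int c" and D\<^sub>2: "D\<^sub>2 = 1"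
    and "odd k\<^sub>2" "odd c" and r: "r = Omega" and s: "s = Omega + of_int \<tau>" and \<tau>: "\<tau> = 0 \<or> \<tau> = 1"
  shows "\<exists>V \<Phi>. hom_on V \<Phi> \<and> ring_of_integers (Q_adjoin \<alpha>) \<subseteq> V \<and> \<Phi> \<alpha> = r \<and> \<Phi> \<eta> = s"
proof -
  note res = \<phi>_simps trans[OF \<phi>_\<alpha> r] trans[OF \<phi>_\<eta> s]
  define g where "g = \<alpha> ^ 3 - 1"
  define f where "f = ieval E \<alpha>"
  have G: "ieval [:-1, 0, 0, 1:] \<alpha> = g" unfolding g_def by (simp add: power3_eq_cube)
  have U': "ieval U \<alpha> = g ^ 2" unfolding U by (simp only: ieval_simps poly_power G)
  have D\<^sub>1': "ieval D\<^sub>1 \<alpha> = of_int k\<^sub>3 * g + of_int k\<^sub>2"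
    unfolding D\<^sub>1 by (simp only: ieval_simps poly_add poly_mult G ieval_of_int)
  have f: "f = of_int k\<^sub>1 * g + of_int c"
    unfolding f_def E by (simp only: ieval_simps poly_add poly_mult G ieval_of_int)
  have gR: "g \<in> R" "\<phi> g = 0"
    unfolding g_def by (simp_all add: res power3_eq_cube)
  have fR: "f \<in> R" "\<phi> f = 1"
    unfolding f using gR \<open>odd c\<close> by (simp_all add: res gf4_of_int)
  have pi: "g \<in> local_multiples g" using gR(1) by (rule local_multiples_base)
  have f2: "f * 2 = g ^ 2 * (- \<eta>)" using U_\<eta> by (simp add: U' f_def algebra_simps)
  then have "f * 2 = g * (g * (- \<eta>))" by (simp add: power2_eq_square)
  then have "f * 2 \<in> local_multiples g"
    using local_multiples_mult(1)[OF pi, of "g * (- \<eta>)"] gR by (simp add: R_closed)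
  then have two: "2 \<in> local_multiples g"
    by (rule local_multiples_cancel) (simp_all add: fR R_closed)
  have quad: "\<alpha>\<^sup>2 + \<alpha> + 1 \<in> local_multiples g"
    using pi unfolding g_def by (rule quadratic_in_local_multiples[OF r])
  obtain k where k: "k\<^sub>2 = 2 * k + 1" using \<open>odd k\<^sub>2\<close> by (rule oddE)
  obtain c' where c': "c = 2 * c' + 1" using \<open>odd c\<close> by (rule oddE)
  define \<sigma> where "\<sigma> = \<alpha> + of_int \<tau>"
  \<comment> \<open>Modulo \<open>g\<close>, 2 and \<open>\<alpha>^2 + \<alpha> + 1\<close>, both
    \<alpha> and \<open>\<eta>\<close> are roots of \<open>x^2 + x + 1\<close>, so the difference of
    the two equations factors. The first factor has residue 1 and can be cancelled.\<close>
  have "(\<eta> + \<alpha> + 1 - of_int \<tau>) * (\<eta> - \<sigma>) =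
      g * (of_int k\<^sub>3 * \<eta> - of_int k\<^sub>1) + 2 * ((of_int k + 1 - of_int \<tau>) * \<eta> - of_int c')
      + (\<alpha>\<^sup>2 + \<alpha> + 1) * (- 1)"
  proof -
    have "(\<eta> + \<alpha> + 1 - of_int \<tau>) * (\<eta> - \<sigma>) = \<eta>\<^sup>2 + (1 - 2 * of_int \<tau>) * \<eta> - \<alpha>\<^sup>2 - \<alpha>"
      using \<tau> unfolding \<sigma>_def by (auto simp: algebra_simps power2_eq_square)
    also have "\<eta>\<^sup>2 = (of_int k\<^sub>3 * g + of_int k\<^sub>2) * \<eta> - f"
      using \<eta>_square by (simp add: D\<^sub>1' f_def D\<^sub>2)
    finally show ?thesis unfolding f k c' by (simp add: algebra_simps)
  qed
  moreover have "\<dots> \<in> local_multiples g"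
    by (intro local_multiples_add local_multiples_mult(1) pi two quad) (simp_all add: R_closed)
  ultimately have "(\<eta> + \<alpha> + 1 - of_int \<tau>) * (\<eta> - \<sigma>) \<in> local_multiples g" by simp
  then have \<eta>: "\<eta> - \<sigma> \<in> local_multiples g"
    by (rule local_multiples_cancel) (simp_all add: \<sigma>_def res)
  have s': "s = ieval [:\<tau>, 1:] Omega" unfolding s by simp
  have \<sigma>': "\<sigma> = ieval [:\<tau>, 1:] \<alpha>" unfolding \<sigma>_def by simp
  show ?thesis
  proof (rule extends_to_ring_of_integers[OF gR _ fR(1) _ _ _ f2])
    show "x \<in> local_multiples g" if "x \<in> R" "\<phi> x = 0" for x
      using kernel_in_local_multiples[OF r s' two quad \<eta>[unfolded \<sigma>'] that] .
    show "\<phi> (- \<eta>) \<noteq> 0" using \<tau> by (auto simp: res)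
  qed (simp_all add: R_closed fR)
qed

text \<open>Here \<alpha> maps to 1 and the four-element residue field comes from
  \<open>\<eta>\<close>. An element \<open>p(\<alpha>) + q(\<alpha>) * \<eta>\<close> of the kernel
  has \<open>p(1)\<close> and \<open>q(1)\<close> even, so expansion at 1 shows that
  \<open>y\<close> and 2 generate the kernel.\<close>

lemma extension_wild_linear:
  assumes U: "U = [:-1, 1:]\<^sup>2" and E: "E = of_int k\<^sub>1 * [:-1, 1:] + of_int c"
    and "odd c" and r: "r = 1" and s: "s = Omega"
  shows "\<exists>V \<Phi>. hom_on V \<Phi> \<and> ring_of_integers (Q_adjoin \<alpha>) \<subseteq> V \<and> \<Phi> \<alpha> = r \<and> \<Phi> \<eta> = s"
proof -
  note res = \<phi>_simps trans[OF \<phi>_\<alpha> r] trans[OF \<phi>_\<eta> s]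
  define y where "y = \<alpha> - 1"
  define f where "f = ieval E \<alpha>"
  have Y: "ieval [:-1, 1:] \<alpha> = y" unfolding y_def by simp
  have U': "ieval U \<alpha> = y ^ 2" unfolding U by (simp only: ieval_simps poly_power Y)
  have f: "f = of_int k\<^sub>1 * y + of_int c"
    unfolding f_def E by (simp only: ieval_simps poly_add poly_mult Y ieval_of_int)
  have yR: "y \<in> R" "\<phi> y = 0" unfolding y_def by (simp_all add: res)
  have fR: "f \<in> R" "\<phi> f = 1"
    unfolding f using yR \<open>odd c\<close> by (simp_all add: res gf4_of_int)
  have pi: "y \<in> local_multiples y" using yR(1) by (rule local_multiples_base)
  have f2: "f * 2 = y ^ 2 * (- \<eta>)" using U_\<eta> by (simp add: U' f_def algebra_simps)
  then have "f * 2 = y * (y * (- \<eta>))" by (simp add: power2_eq_square)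
  then have "f * 2 \<in> local_multiples y"
    using local_multiples_mult(1)[OF pi, of "y * (- \<eta>)"] yR by (simp add: R_closed)
  then have two: "2 \<in> local_multiples y"
    by (rule local_multiples_cancel) (simp_all add: fR R_closed)
  have Taylor: "\<exists>k. p = [:-1, 1:] * k + of_int (poly p 1)" for p :: "int poly"
  proof -
    have "[:- 1, 1:] dvd p - of_int (poly p 1)" by (simp flip: poly_eq_0_iff_dvd)
    then show ?thesis by (metis dvd_def diff_eq_eq)
  qed
  show ?thesis
  proof (rule extends_to_ring_of_integers[OF yR _ fR(1) _ _ _ f2])
    fix x assume "x \<in> R" "\<phi> x = 0"
    then obtain p q where x: "x = ieval p \<alpha> + ieval q \<alpha> * \<eta>" unfolding R_def by blast
    have "ieval p r + ieval q r * s = 0" using \<open>\<phi> x = 0\<close> unfolding x \<phi>_eq .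
    then have "of_int (poly p 1) + of_int (poly q 1) * Omega = 0" by (simp add: r s)
    then have "even (poly p 1) \<and> even (poly q 1)"
      by (auto simp: gf4_of_int split: if_splits)
    then obtain p\<^sub>0 q\<^sub>0 where even: "poly p 1 = 2 * p\<^sub>0" "poly q 1 = 2 * q\<^sub>0" by (auto elim!: evenE)
    obtain p' where p': "p = [:-1, 1:] * p' + of_int (2 * p\<^sub>0)" using Taylor[of p] even by auto
    obtain q' where q': "q = [:-1, 1:] * q' + of_int (2 * q\<^sub>0)" using Taylor[of q] even by auto
    have "ieval p \<alpha> = y * ieval p' \<alpha> + of_int (2 * p\<^sub>0)" "ieval q \<alpha> = y * ieval q' \<alpha> + of_int (2 * q\<^sub>0)"
      by (subst p' q', simp only: ieval_simps poly_add poly_mult Y ieval_of_int)+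
    then have "x = y * (ieval p' \<alpha> + ieval q' \<alpha> * \<eta>) + 2 * (of_int p\<^sub>0 + of_int q\<^sub>0 * \<eta>)"
      unfolding x by (simp add: algebra_simps)
    moreover have "\<dots> \<in> local_multiples y"
      by (intro local_multiples_add local_multiples_mult(1) pi two) (simp_all add: R_closed)
    ultimately show "x \<in> local_multiples y" by simp
  qed (simp_all add: fR res)
qed

text \<open>The equation for \<open>w\<close> makes 2 a positive power of \<open>h\<close> up to
  local units; \<open>Suc e\<close> supplies the factor \<open>h\<close> to split off. As
  \<open>\<eta>\<close> has residue 0 and \<open>D\<^sub>1\<close> does not vanish at
  \<open>Omega\<close>, the factor \<open>\<eta> - D\<^sub>1(\<alpha>)\<close> is a local unit, so
  \<open>\<eta>\<close> is a multiple of \<open>h\<close> too.\<close>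

lemma extension_Eisenstein:
  assumes r: "r = Omega" and s: "s = 0" and "ieval D\<^sub>2 Omega = 0" "ieval D\<^sub>1 Omega \<noteq> 0"
    and w: "ieval w Omega \<noteq> 0" "ieval v Omega \<noteq> 0" "ieval w \<alpha> * 2 = (\<alpha>\<^sup>2 + \<alpha> + 1) ^ Suc e * ieval v \<alpha>"
  shows "\<exists>V \<Phi>. hom_on V \<Phi> \<and> ring_of_integers (Q_adjoin \<alpha>) \<subseteq> V \<and> \<Phi> \<alpha> = r \<and> \<Phi> \<eta> = s"
proof -
  note res = \<phi>_simps trans[OF \<phi>_\<alpha> r] trans[OF \<phi>_\<eta> s]
    trans[OF \<phi>_ieval arg_cong[OF r, of "ieval _"]]
  define h where "h = \<alpha>\<^sup>2 + \<alpha> + 1"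
  have hR: "h \<in> R" "\<phi> h = 0" unfolding h_def by (simp_all add: res power2_eq_square)
  have quad: "h \<in> local_multiples h" using hR(1) by (rule local_multiples_base)
  then have quad': "\<alpha>\<^sup>2 + \<alpha> + 1 \<in> local_multiples h" unfolding h_def .
  have "ieval w \<alpha> * 2 = h * (h ^ e * ieval v \<alpha>)" using w(3) unfolding h_def by simp
  then have "ieval w \<alpha> * 2 \<in> local_multiples h"
    using local_multiples_mult(1)[OF quad, of "h ^ e * ieval v \<alpha>"] hR by (simp add: R_closed)
  then have two: "2 \<in> local_multiples h"
    by (rule local_multiples_cancel) (use w in \<open>simp_all add: res\<close>)
  have D\<^sub>2: "ieval D\<^sub>2 \<alpha> \<in> local_multiples h"
    by (rule ieval_in_local_multiples[OF r two quad' assms(3)])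
  have "(\<eta> - ieval D\<^sub>1 \<alpha>) * \<eta> = ieval D\<^sub>2 \<alpha> * (- ieval E \<alpha>)"
    using \<eta>_square by (simp add: algebra_simps power2_eq_square)
  then have "(\<eta> - ieval D\<^sub>1 \<alpha>) * \<eta> \<in> local_multiples h"
    using local_multiples_mult(1)[OF D\<^sub>2, of "- ieval E \<alpha>"] by (simp add: R_closed)
  then have \<eta>: "\<eta> \<in> local_multiples h"
    by (rule local_multiples_cancel) (use assms(4) in \<open>simp_all add: res\<close>)
  show ?thesis
  proof (rule extends_to_ring_of_integers[OF hR _ ieval_in_R ieval_in_R _ _ w(3)[folded h_def]])
    show "x \<in> local_multiples h" if "x \<in> R" "\<phi> x = 0" for x
      using kernel_in_local_multiples[OF r _ two quad', of 0 x] that s \<eta> by simp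
  qed (use w in \<open>simp_all add: res\<close>)
qed

end

section \<open>The trinomials\<close>

text \<open>In powers of \<open>G\<close> the Newton polygon has a side of length 1 and one of slope
  -1/3. At \<open>Omega\<close> the equation for \<open>s\<close> reduces to \<open>s^2 = s\<close>;
  its roots 0 and 1 give two primes told apart by \<open>\<eta>\<close>.\<close>

lemma nonconjugate_homs_tame:
  fixes \<alpha> :: "'a::field_char_0" and G :: "int poly"
  defines "G \<equiv> [:-1, 0, 0, 1:]"
  assumes F: "F = G ^ 4 + 2 * of_int k\<^sub>3 * G ^ 3 + 2 * of_int k\<^sub>2 * G\<^sup>2 + 2 * of_int u * G + 4 * of_int c"
    and "odd u" and monic: "lead_coeff F = 1" and root: "\<And>p. ieval p \<alpha> = 0 \<longleftrightarrow> F dvd p"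
  shows "nonconjugate_gf4_homs (ring_of_integers (Q_adjoin \<alpha>))"
proof -
  define D where "D = G\<^sup>2 + 2 * of_int k\<^sub>3 * G + 2 * of_int k\<^sub>2"
  interpret quadratic_order \<alpha> F G "of_int u" D "of_int c"
  proof
    show "F = G\<^sup>2 * D + 2 * G * of_int u + 4 * of_int c"
      unfolding F D_def by (simp add: algebra_simps power2_eq_square power3_eq_cube power4_eq_xxxx)
  qed (rule monic root)+
  have G: "ieval G Omega = 0" unfolding G_def by simp
  then have D: "ieval D Omega = 0" unfolding D_def by (simp only: ieval_simps poly_add poly_mult poly_power ieval_numeral) simp
  have res: "gf4_residue \<alpha> F G (of_int u) D (of_int c) Omega s" if "s = 0 \<or> s = 1" for s
    by unfold_locales (use that \<open>odd u\<close> in \<open>auto simp: G D gf4_of_int\<close>)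
  have G': "G = [:-1, 0, 0, 1:]" by (simp add: G_def)
  obtain V \<Phi> where V: "hom_on V \<Phi>" "ring_of_integers (Q_adjoin \<alpha>) \<subseteq> V" "\<Phi> \<alpha> = Omega" "\<Phi> \<eta> = 1"
    using gf4_residue.extension_tame_1[OF res[of 1] G' refl refl D_def \<open>odd u\<close> refl refl] by auto
  obtain W \<Psi> where W: "hom_on W \<Psi>" "ring_of_integers (Q_adjoin \<alpha>) \<subseteq> W" "\<Psi> \<alpha> = Omega" "\<Psi> \<eta> = 0"
    using gf4_residue.extension_tame_0[OF res[of 0] G' refl refl D_def \<open>odd u\<close> refl refl] by auto
  have mem: "\<alpha> \<in> ring_of_integers (Q_adjoin \<alpha>)" "\<eta> \<in> ring_of_integers (Q_adjoin \<alpha>)"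
    using R_subset_ring_of_integers \<alpha>_in_R \<eta>_in_R by auto
  show ?thesis
    by (rule nonconjugate_gf4_homsI[OF V(1,2) W(1,2) mem(1) _ mem(1) _ mem(2)]) (simp_all add: V W)
qed

text \<open>The Newton polygon is one side of slope -1/2 whose residual polynomial
  \<open>t^2 + t + 1\<close> splits over the residue field. Both maps send \<open>\<eta>\<close>
  outside the prime field, so \<open>\<alpha> + \<eta>\<close>, with values 0 and 1, separates
  them.\<close>

lemma nonconjugate_homs_wild_cube:
  fixes \<alpha> :: "'a::field_char_0" and G :: "int poly"
  defines "G \<equiv> [:-1, 0, 0, 1:]"
  assumes F: "F = G ^ 4 + 2 * of_int k\<^sub>3 * G ^ 3 + 2 * of_int k\<^sub>2 * G\<^sup>2 + 4 * of_int k\<^sub>1 * G + 4 * of_int c"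
    and odd: "odd k\<^sub>2" "odd c" and monic: "lead_coeff F = 1" and root: "\<And>p. ieval p \<alpha> = 0 \<longleftrightarrow> F dvd p"
  shows "nonconjugate_gf4_homs (ring_of_integers (Q_adjoin \<alpha>))"
proof -
  define D where "D = of_int k\<^sub>3 * G + of_int k\<^sub>2"
  define E where "E = of_int k\<^sub>1 * G + of_int c"
  interpret quadratic_order \<alpha> F "G\<^sup>2" D 1 E
  proof
    show "F = (G\<^sup>2)\<^sup>2 * 1 + 2 * G\<^sup>2 * D + 4 * E"
      unfolding F D_def E_def by (simp add: algebra_simps power2_eq_square power3_eq_cube power4_eq_xxxx)
  qed (rule monic root)+
  have G: "ieval G Omega = 0" unfolding G_def by simp
  then have DE: "ieval D Omega = 1" "ieval E Omega = 1"
    unfolding D_def E_def using odd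
    by (simp_all only: ieval_simps poly_add poly_mult ieval_of_int gf4_of_int) simp_all
  have res: "gf4_residue \<alpha> F (G\<^sup>2) D 1 E Omega (Omega + of_int \<tau>)" if "\<tau> = 0 \<or> \<tau> = 1" for \<tau>
    by unfold_locales (use that in \<open>auto simp: G DE ieval_simps power2_eq_square algebra_simps\<close>)
  have ext: "\<exists>V \<Phi>. hom_on V \<Phi> \<and> ring_of_integers (Q_adjoin \<alpha>) \<subseteq> V \<and> \<Phi> \<alpha> = Omega \<and> \<Phi> \<eta> = Omega + of_int \<tau>"
    if "\<tau> = 0 \<or> \<tau> = 1" for \<tau>
    using gf4_residue.extension_wild_cube[OF res[OF that] _ D_def[unfolded G_def] E_def[unfolded G_def]
      refl odd refl refl that] unfolding G_def by blast
  obtain V \<Phi> where V: "hom_on V \<Phi>" "ring_of_integers (Q_adjoin \<alpha>) \<subseteq> V" "\<Phi> \<alpha> = Omega" "\<Phi> \<eta> = Omega"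
    using ext[of 0] by auto
  obtain W \<Psi> where W: "hom_on W \<Psi>" "ring_of_integers (Q_adjoin \<alpha>) \<subseteq> W" "\<Psi> \<alpha> = Omega" "\<Psi> \<eta> = Omega + 1"
    using ext[of 1] by auto
  have mem: "\<alpha> \<in> ring_of_integers (Q_adjoin \<alpha>)" "\<eta> \<in> ring_of_integers (Q_adjoin \<alpha>)"
    using R_subset_ring_of_integers \<alpha>_in_R \<eta>_in_R by auto
  have sum: "\<Phi> (\<alpha> + \<eta>) = \<Phi> \<alpha> + \<Phi> \<eta>" "\<Psi> (\<alpha> + \<eta>) = \<Psi> \<alpha> + \<Psi> \<eta>"
    by (rule hom_onD(4)[OF V(1)] hom_onD(4)[OF W(1)]; use mem V(2) W(2) in blast)+
  show ?thesis
    by (rule nonconjugate_gf4_homsI[OF V(1,2) W(1,2) mem(1) _ mem(1) _ ring_of_integers_add[OF mem]])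
      (simp_all add: V W sum flip: add.assoc)
qed

text \<open>Modulo 2, \<open>F\<close> is \<open>G^4\<close>, with factors \<open>x - 1\<close> and
  \<open>x^2 + x + 1\<close>. One prime is taken over each: over the first the residue field is
  enlarged by \<open>\<eta>\<close>, over the second \<open>F\<close> is of Eisenstein type. The
  images 1 and \<open>Omega\<close> of \<alpha> separate them.\<close>

lemma nonconjugate_homs_wild_linear:
  fixes \<alpha> :: "'a::field_char_0" and Y G :: "int poly"
  defines "Y \<equiv> [:-1, 1:]" and "G \<equiv> [:-1, 0, 0, 1:]"
  assumes F: "F = Y ^ 4 * D\<^sub>2 + 4 * of_int k\<^sub>3 * Y ^ 3 + 2 * of_int k\<^sub>2 * Y\<^sup>2 + 4 * of_int k\<^sub>1 * Y + 4 * of_int c"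
    and odd: "odd k\<^sub>2" "odd c" "odd (poly D\<^sub>2 1)" and D\<^sub>2: "ieval D\<^sub>2 Omega = 0"
    and Fw: "F = G ^ 4 + 2 * w" and w: "ieval w Omega \<noteq> 0"
    and monic: "lead_coeff F = 1" and root: "\<And>p. ieval p \<alpha> = 0 \<longleftrightarrow> F dvd p"
  shows "nonconjugate_gf4_homs (ring_of_integers (Q_adjoin \<alpha>))"
proof -
  define D where "D = 2 * of_int k\<^sub>3 * Y + of_int k\<^sub>2"
  define E where "E = of_int k\<^sub>1 * Y + of_int c"
  interpret quadratic_order \<alpha> F "Y\<^sup>2" D D\<^sub>2 E
  proof
    show "F = (Y\<^sup>2)\<^sup>2 * D\<^sub>2 + 2 * Y\<^sup>2 * D + 4 * E"
      unfolding F D_def E_def by (simp add: algebra_simps power2_eq_square power3_eq_cube power4_eq_xxxx)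
  qed (rule monic root)+
  have eval: "ieval Y x = x + 1" "ieval D x = 1" "ieval E x = of_int k\<^sub>1 * (x + 1) + 1" for x :: gf4
  proof -
    show Y: "ieval Y x = x + 1" unfolding Y_def by (simp add: add.commute)
    show "ieval D x = 1" "ieval E x = of_int k\<^sub>1 * (x + 1) + 1"
      unfolding D_def E_def using odd
      by (simp_all only: ieval_simps poly_add poly_mult ieval_of_int gf4_of_int ieval_numeral Y) simp_all
  qed
  have "ieval D\<^sub>2 1 = (1::gf4)" using odd(3) by (simp add: gf4_of_int)
  moreover have "ieval (Y\<^sup>2) 1 = (0::gf4)"
    by (simp only: ieval_simps poly_power eval) simp
  moreover have "ieval E 1 = (1::gf4)" by (simp only: eval) simp
  moreover note eval(2)[of 1]
  ultimately have "gf4_residue \<alpha> F (Y\<^sup>2) D D\<^sub>2 E 1 Omega"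
    by unfold_locales (simp_all only:, simp_all add: power2_eq_square)
  then obtain V \<Phi> where V: "hom_on V \<Phi>" "ring_of_integers (Q_adjoin \<alpha>) \<subseteq> V" "\<Phi> \<alpha> = 1" "\<Phi> \<eta> = Omega"
    using gf4_residue.extension_wild_linear[OF _ _ E_def[unfolded Y_def] odd(2) refl refl] unfolding Y_def by blast
  have res: "gf4_residue \<alpha> F (Y\<^sup>2) D D\<^sub>2 E Omega 0"
    by unfold_locales (use D\<^sub>2 in simp_all)
  have v: "ieval (- (Y ^ 4)) Omega \<noteq> 0" by (simp add: eval ieval_simps)
  \<comment> \<open>From \<open>F(\<alpha>) = 0\<close> and \<open>G = (x^2 + x + 1) * Y\<close>;
    the factor \<open>- (Y^4)\<close> is a local unit at \<open>Omega\<close>.\<close>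
  have wv: "ieval w \<alpha> * 2 = (\<alpha>\<^sup>2 + \<alpha> + 1) ^ Suc 3 * ieval (- (Y ^ 4)) \<alpha>"
  proof -
    have "ieval F \<alpha> = 0" by (simp add: root)
    then have "2 * ieval w \<alpha> = - (ieval G \<alpha> ^ 4)"
      unfolding Fw by (simp add: ieval_simps eq_neg_iff_add_eq_0 add.commute)
    also have "ieval G \<alpha> = (\<alpha>\<^sup>2 + \<alpha> + 1) * ieval Y \<alpha>"
      unfolding G_def Y_def by (simp add: algebra_simps power2_eq_square)
    finally show ?thesis by (simp add: ieval_simps power_mult_distrib mult.commute)
  qed
  have "ieval D Omega \<noteq> 0" by (simp add: eval)
  then obtain W \<Psi> where W: "hom_on W \<Psi>" "ring_of_integers (Q_adjoin \<alpha>) \<subseteq> W" "\<Psi> \<alpha> = Omega"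
    using gf4_residue.extension_Eisenstein[OF res refl refl D\<^sub>2 _ w v wv] by blast
  have mem: "\<alpha> \<in> ring_of_integers (Q_adjoin \<alpha>)" "\<eta> \<in> ring_of_integers (Q_adjoin \<alpha>)"
    using R_subset_ring_of_integers \<alpha>_in_R \<eta>_in_R by auto
  show ?thesis
    by (rule nonconjugate_gf4_homsI[OF V(1,2) W(1,2) mem(2) _ mem(1) _ mem(1)]) (simp_all add: V W)
qed

section \<open>From the irreducible trinomial to explicit expansions\<close>

text \<open>For monic \<open>F\<close> pseudo-division is true division over the integers. A nonzero
  remainder would yield a rational polynomial of least degree vanishing at \<alpha>, of degree below
  that of \<open>F\<close> yet dividing \<open>F\<close>.\<close>

lemma ieval_eq_0_iff_dvd:
  fixes \<alpha> :: "'a::field_char_0"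
  assumes irr: "irreducible (map_poly of_int F :: rat poly)" and monic: "lead_coeff F = 1"
    and root: "ieval F \<alpha> = 0"
  shows "ieval p \<alpha> = 0 \<longleftrightarrow> F dvd p"
proof
  assume "F dvd p"
  then show "ieval p \<alpha> = 0" using root by (auto simp: dvd_def ieval_simps)
next
  assume p: "ieval p \<alpha> = 0"
  have "F \<noteq> 0" using monic by auto
  obtain q r where "pseudo_divmod p F = (q, r)" by (cases "pseudo_divmod p F")
  then have qr: "p = F * q + r" "r = 0 \<or> degree r < degree F"
    using pseudo_divmod[OF \<open>F \<noteq> 0\<close>] monic by auto
  have r0: "ieval r \<alpha> = 0" using p root unfolding qr(1) by (simp add: ieval_simps)
  have "r = 0"
  proof (rule ccontr)
    assume "r \<noteq> 0"
    interpret of_rat_poly: map_poly_comm_ring_hom "of_rat :: rat \<Rightarrow> 'a"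
      by unfold_locales (simp_all add: of_rat_add of_rat_mult)
    let ?F = "map_poly of_int F :: rat poly" and ?r = "map_poly of_int r :: rat poly"
    have ev: "poly (map_poly of_rat (map_poly of_int f :: rat poly)) \<alpha> = ieval f \<alpha>" for f
      by (simp add: map_poly_map_poly comp_def)
    let ?P = "\<lambda>f :: rat poly. f \<noteq> 0 \<and> poly (map_poly of_rat f) \<alpha> = 0"
    have "?P ?r" using \<open>r \<noteq> 0\<close> ev r0 by simp
    then obtain g where g: "?P g" and min: "\<And>f. ?P f \<Longrightarrow> degree g \<le> degree f"
      using ex_has_least_nat[of ?P ?r degree] by blast
    have "poly (map_poly of_rat (?F div g * g + ?F mod g)) \<alpha> = 0"
      using ev root by simp
    then have "poly (map_poly of_rat (?F mod g)) \<alpha> = 0"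
      using g by (simp only: of_rat_poly.hom_add of_rat_poly.hom_mult poly_add poly_mult) simp
    then have "?F mod g = 0"
      using min[of "?F mod g"] degree_mod_less'[of g ?F] g by fastforce
    then have "g dvd ?F" by (rule dvd_eq_mod_eq_0[THEN iffD2])
    then consider "?F dvd g" | "is_unit g" using irreducibleD'[OF irr] by blast
    then show False
    proof cases
      case 1
      then have "degree ?F \<le> degree g" using g by (intro dvd_imp_degree_le) auto
      also have "\<dots> \<le> degree ?r" using \<open>?P ?r\<close> by (rule min)
      finally show False using qr(2) \<open>r \<noteq> 0\<close> by simp
    next
      case 2
      then obtain h where "g * h = 1" by (auto simp: dvd_def)
      then have "poly (map_poly of_rat (g * h)) \<alpha> = 1" by simp
      then show False
        using g by (simp only: of_rat_poly.hom_mult poly_mult) simp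
    qed
  qed
  then show "F dvd p" using qr(1) by simp
qed

lemma concrete_poly_simps:
  "of_int k = [:k:]" "(numeral n :: int poly) = [:numeral n:]"
  "monom c (numeral n) = pCons 0 (monom c (pred_numeral n))" "monom c (Suc l) = pCons 0 (monom c l)"
  "monom c 0 = [:c:]"
  for c k :: int
  by (simp_all add: of_int_poly numeral_poly numeral_eq_Suc monom_Suc monom_0)

text \<open>For \<open>m \<in> {4, 8}\<close> the long coefficient list is the quotient of \<open>F\<close> by \<open>(x - 1)\<^sup>4\<close>; its entries come from
  \<open>x\<^sup>n = (x - 1)\<^sup>4 (\<Sum>i\<le>n-4. (n-1-i choose 3) x\<^sup>i)\<close> plus a cubic remainder.\<close>

lemma nonconjugate_homs_trinomial:
  fixes \<alpha> :: "'a::field_char_0" and F :: "int poly" and m :: nat and a b :: int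
  defines "F \<equiv> monom 1 12 + monom a m + [:b:]"
  assumes cond: "(m \<in> {3, 4, 8, 9} \<and>
            ([a = 2] (mod 8) \<and> [b = 1] (mod 8) \<or> [a = 6] (mod 8) \<and> [b = 5] (mod 8)))
       \<or> (m \<in> {3, 6, 9} \<and> [a = 4] (mod 8) \<and> [b = 7] (mod 8))"
    and monic: "lead_coeff F = 1" and root: "\<And>p. ieval p \<alpha> = 0 \<longleftrightarrow> F dvd p"
  shows "nonconjugate_gf4_homs (ring_of_integers (Q_adjoin \<alpha>))"
  using cond
proof (elim disjE conjE)
  \<comment> \<open>Even \<open>j\<close> gives the classes (2, 1) and odd \<open>j\<close> the
    classes (6, 5). In both, \<open>1 + a + b = 4 * (2 * l + 1)\<close>, so the constant term of
    each expansion is 4 times an odd number.\<close>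
  have main: ?thesis if m: "m \<in> {3, 4, 8, 9}" and ab: "a = 4 * j + 2" "b = 8 * l + 1 - 4 * j" for j l
  proof -
    from m consider "m = 3" | "m = 9" | "m = 4" | "m = 8" by auto
    then show ?thesis
    proof cases
      case 1
      \<comment> \<open>The witnesses are read off from \<open>x^3 = G + 1\<close>: here
        \<open>F = (G + 1)^4 + a * (G + 1) + b\<close>, and for \<open>m = 9\<close> the middle term
        is \<open>a * (G + 1)^3\<close>.\<close>
      show ?thesis
        by (rule nonconjugate_homs_tame[OF _ _ monic root, of 2 3 "2 * j + 3" "2 * l + 1"])
          (simp_all add: F_def 1 ab concrete_poly_simps eval_nat_numeral)
    next
      case 2
      show ?thesis
        by (rule nonconjugate_homs_tame[OF _ _ monic root, of "2 * j + 3" "6 * j + 6" "6 * j + 5" "2 * l + 1"])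
          (simp_all add: F_def 2 ab concrete_poly_simps eval_nat_numeral)
    next
      case 3
      \<comment> \<open>After the quotient come the Taylor coefficients of \<open>F\<close> at 1,
        with the factors 4, 2, 4, 4 removed. The last polynomial is half of \<open>F - G^4\<close>,
        from \<open>x^12 = (G + 1)^4\<close>; at \<open>Omega\<close> it is
        \<open>Omega + 1\<close>, because \<open>m\<close> is 1 or 2 modulo 3.\<close>
      show ?thesis
        by (rule nonconjugate_homs_wild_linear[OF _ _ _ _ _ _ _ monic root, of "[:165 + a, 120, 84, 56, 35, 20, 10, 4, 1:]"
              "55 + a" "33 + 3 * a" "3 + a" "2 * l + 1"
              "monom (2 * j + 1) 4 + of_int (4 * l + 1 - 2 * j) + 2 * [:-1, 0, 0, 1:] ^ 3 + 3 * [:-1, 0, 0, 1:]\<^sup>2 + 2 * [:-1, 0, 0, 1:]"])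
          (simp_all add: F_def 3 ab concrete_poly_simps eval_nat_numeral)
    next
      case 4
      show ?thesis
        by (rule nonconjugate_homs_wild_linear[OF _ _ _ _ _ _ _ monic root,
              of "[:165 + 35 * a, 120 + 20 * a, 84 + 10 * a, 56 + 4 * a, 35 + a, 20, 10, 4, 1:]"
              "55 + 14 * a" "33 + 14 * a" "3 + 2 * a" "2 * l + 1"
              "monom (2 * j + 1) 8 + of_int (4 * l + 1 - 2 * j) + 2 * [:-1, 0, 0, 1:] ^ 3 + 3 * [:-1, 0, 0, 1:]\<^sup>2 + 2 * [:-1, 0, 0, 1:]"])
          (simp_all add: F_def 4 ab concrete_poly_simps eval_nat_numeral)
    qed
  qed
  {
    assume m: "m \<in> {3, 4, 8, 9}" and "[a = 2] (mod 8)" "[b = 1] (mod 8)"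
    then have "8 dvd a - 2" "8 dvd b - 1" by (simp_all add: cong_iff_dvd_diff)
    then obtain i n where "a = 8 * i + 2" "b = 8 * n + 1" by (auto simp: dvd_def algebra_simps)
    then show ?thesis using main[OF m, of "2 * i" "n + i"] by simp
  next
    assume m: "m \<in> {3, 4, 8, 9}" and "[a = 6] (mod 8)" "[b = 5] (mod 8)"
    then have "8 dvd a - 6" "8 dvd b - 5" by (simp_all add: cong_iff_dvd_diff)
    then obtain i n where "a = 8 * i + 6" "b = 8 * n + 5" by (auto simp: dvd_def algebra_simps)
    then show ?thesis using main[OF m, of "2 * i + 1" "n + i + 1"] by simp
  next
    assume m: "m \<in> {3, 6, 9}" and "[a = 4] (mod 8)" "[b = 7] (mod 8)"
    then have "8 dvd a - 4" "8 dvd b - 7" by (simp_all add: cong_iff_dvd_diff)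
    then obtain i n where ab: "a = 8 * i + 4" "b = 8 * n + 7" by (auto simp: dvd_def algebra_simps)
    from m consider "m = 3" | "m = 6" | "m = 9" by auto
    then show ?thesis
    proof cases
      case 1
      \<comment> \<open>Again the expansion in \<open>G\<close>: as 4 divides \<open>a\<close>, the
        coefficient of \<open>G\<close> is divisible by 4, and \<open>1 + a + b\<close> is 4 modulo
        8.\<close>
      show ?thesis
        by (rule nonconjugate_homs_wild_cube[OF _ _ _ monic root, of 2 3 "2 * i + 2" "2 * (i + n) + 3"])
          (simp_all add: F_def 1 ab concrete_poly_simps eval_nat_numeral)
    next
      case 2
      show ?thesis
        by (rule nonconjugate_homs_wild_cube[OF _ _ _ monic root, of 2 "4 * i + 5" "4 * i + 3" "2 * (i + n) + 3"])
          (simp_all add: F_def 2 ab concrete_poly_simps eval_nat_numeral)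
    next
      case 3
      show ?thesis
        by (rule nonconjugate_homs_wild_cube[OF _ _ _ monic root, of "4 * i + 4" "12 * i + 9" "6 * i + 4" "2 * (i + n) + 3"])
          (simp_all add: F_def 3 ab concrete_poly_simps eval_nat_numeral)
    qed
  }
qed

theorem theorem2p2:
  fixes m :: nat and a b :: int and \<alpha> :: "'a::field_char_0"
  assumes "m \<in> {1..11}"
    and "\<And>p :: nat. prime p \<Longrightarrow> padic_val p a < enat (12 - m) \<or> padic_val p b < 12"
    and "irreducible (trinomial 12 m a b)"
    and "poly (map_poly of_rat (trinomial 12 m a b)) \<alpha> = 0"
    and "(m \<in> {3, 4, 8, 9} \<and>
            ([a = 2] (mod 8) \<and> [b = 1] (mod 8) \<or> [a = 6] (mod 8) \<and> [b = 5] (mod 8)))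
       \<or> (m \<in> {3, 6, 9} \<and> [a = 4] (mod 8) \<and> [b = 7] (mod 8))"
  shows "2 dvd field_index (Q_adjoin \<alpha>) \<and> \<not> monogenic (Q_adjoin \<alpha>)"
proof -
  define F :: "int poly" where "F = monom 1 12 + monom a m + [:b:]"
  let ?O = "ring_of_integers (Q_adjoin \<alpha>)"
  have trinomial: "trinomial 12 m a b = map_poly of_int F"
    unfolding trinomial_def F_def by (simp add: ieval_simps map_poly_monom Polynomial.map_poly_pCons)
  have "coeff F 12 = 1" "degree F \<le> 12"
    unfolding F_def using assms(1)
    by (auto simp: coeff_pCons numeral_eq_Suc intro!: degree_add_le degree_monom_le[THEN order_trans])
  moreover from this have "degree F = 12" using le_degree[of F 12] by simp
  ultimately have monic: "lead_coeff F = 1" by simp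
  have "ieval F \<alpha> = 0"
    using assms(4) unfolding trinomial by (simp add: map_poly_map_poly comp_def)
  then have root: "ieval p \<alpha> = 0 \<longleftrightarrow> F dvd p" for p
    using assms(3) unfolding trinomial by (intro ieval_eq_0_iff_dvd monic)
  have homs: "nonconjugate_gf4_homs ?O"
    using nonconjugate_homs_trinomial[OF assms(5)] monic root unfolding F_def by blast
  have "2 dvd field_index (Q_adjoin \<alpha>)"
    unfolding field_index_def using index_even[OF homs] by (intro Gcd_greatest) blast
  moreover have "\<not> monogenic (Q_adjoin \<alpha>)"
    using no_odd_multiple_in_Z_adjoin[OF homs, of _ 1] unfolding monogenic_def by auto
  ultimately show ?thesis by blast
qed

end
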